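(* Among all $k$-uniform linear unicyclic hypergraphs with $m\ge3$ hyperedges, the second last hypergraph in $S_\alpha$-order is $C^{(k)}_{3;m-4,1,0}$ for $k\ge2$ and $0<\alpha<1$.
   Context: Hypergraphs are finite; $k$-uniform means every hyperedge has exactly $k$ vertices; linear means any two distinct hyperedges share at most one vertex; unicyclic means connected with exactly one cycle. A cored vertex is a vertex of degree one. "Adding a pendant hyperedge to a vertex $v$" means adding a new hyperedge consisting of $v$ and $k-1$ new vertices. The hypercycle $C_g^{(k)}$ is obtained from the cycle graph $C_g$ by inserting $k-2$ new (cored) vertices into each edge. $C^{(k)}_{3;n_1,n_2,n_3}$ is the $k$-uniform linear unicyclic hypergraph obtained from $C_3^{(k)}$ by adding $n_1,n_2,n_3$ pendant hyperedges to the three non-cored (degree-two) vertices of $C_3^{(k)}$, respectively. For a $k$-uniform hypergraph $\mathcal{H}$ on $[n]$, $\mathcal{A}(\mathcal{H})$ is the $k$-order $n$-dimensional tensor with entry $\frac1{(k-1)!}$ at $(i_1,\dots,i_k)$ if $\{i_1,\dots,i_k\}\in E(\mathcal{H})$ and $0$ otherwise; $\mathcal{D}(\mathcal{H})$ is the diagonal tensor of vertex degrees; $\mathcal{A}_\alpha(\mathcal{H})=\alpha\mathcal{D}(\mathcal{H})+(1-\alpha)\mathcal{A}(\mathcal{H})$. For a tensor $\mathcal{T}$, $\mathrm{Tr}_d(\mathcal{T})$ is the sum of the $d$-th powers of all $n(k-1)^{n-1}$ eigenvalues of $\mathcal{T}$; in particular $\mathrm{Tr}_0(\mathcal{T})=n(k-1)^{n-1}$,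 and for $d\ge1$ $$\mathrm{Tr}_{d}(\mathcal{T})=(k-1)^{n-1}\sum_{d_1+\cdots+d_n=d}\ \prod_{i=1}^{n}\frac{1}{(d_i(k-1))!}\Big(\sum_{\gamma\in[n]^{k-1}}(\mathcal{T})_{i\gamma}\frac{\partial}{\partial a_{i\gamma}}\Big)^{d_i}\mathrm{tr}\big(A^{d(k-1)}\big),$$ with $A=(a_{ij})$ an $n\times n$ matrix of indeterminates, $d_i\ge0$ integers, $\frac{\partial}{\partial a_{i\gamma}}=\frac{\partial}{\partial a_{i i_2}}\cdots\frac{\partial}{\partial a_{i i_k}}$ for $\gamma=i_2\cdots i_k$. $S_\alpha$-order: for $k$-uniform hypergraphs $\mathcal{H}_1,\mathcal{H}_2$ with $n$ vertices, $\mathcal{H}_1\prec_\alpha\mathcal{H}_2$ ($\mathcal{H}_1$ comes before $\mathcal{H}_2$) if there is $d\in\{1,\dots,n(k-1)^{n-1}-1\}$ with $\mathrm{Tr}_t(\mathcal{A}_\alpha(\mathcal{H}_1))=\mathrm{Tr}_t(\mathcal{A}_\alpha(\mathcal{H}_2))$ for $t=0,\dots,d-1$ and $\mathrm{Tr}_d(\mathcal{A}_\alpha(\mathcal{H}_1))<\mathrm{Tr}_d(\mathcal{A}_\alpha(\mathcal{H}_2))$. The last hypergraph $L$ in a class is the member with $\mathcal{H}\prec_\alpha L$ for every other member $\mathcal{H}$ of the class (up to isomorphism); the second last is the last among the members other than $L$.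
   Formalization: Proved for m ≥ 5 instead of m ≥ 3: for m = 3 the hypergraph C_{3;m-4,1,0} is undefined (m-4 = -1), and for m = 4 it is isomorphic to C_{3;1,0,0}, which is the last hypergraph, so the claim fails there. *)

theory Defs
  imports Jordan_Normal_Form.Matrix "HOL-Library.Poly_Mapping"
begin

section \<open>Hypergraphs on an initial segment of the natural numbers\<close>

text \<open>The vertex set $[n]$ is represented by $\{0,\dots,n-1\}$. Hyperedges form a set, so there are
  no multiple hyperedges.\<close>

datatype hgraph = HGraph (nverts: nat) (hedges: "nat set set")

definition verts :: "hgraph \<Rightarrow> nat set" where
  "verts H = {..<nverts H}"

definition wf_hgraph :: "hgraph \<Rightarrow> bool" where
  "wf_hgraph H \<longleftrightarrow> (\<forall>e\<in>hedges H. e \<subseteq> verts H)"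

definition uniform_hgraph :: "nat \<Rightarrow> hgraph \<Rightarrow> bool" where
  "uniform_hgraph k H \<longleftrightarrow> (\<forall>e\<in>hedges H. card e = k)"

definition linear_hgraph :: "hgraph \<Rightarrow> bool" where
  "linear_hgraph H \<longleftrightarrow> (\<forall>e\<in>hedges H. \<forall>f\<in>hedges H. e \<noteq> f \<longrightarrow> card (e \<inter> f) \<le> 1)"

definition vdegree :: "hgraph \<Rightarrow> nat \<Rightarrow> nat" where
  "vdegree H v = card {e \<in> hedges H. v \<in> e}"

definition adj_rel :: "hgraph \<Rightarrow> (nat \<times> nat) set" where
  "adj_rel H = {(u, v). \<exists>e\<in>hedges H. u \<in> e \<and> v \<in> e}"

definition connected_hgraph :: "hgraph \<Rightarrow> bool" where
  "connected_hgraph H \<longleftrightarrow>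
     verts H \<noteq> {} \<and> (\<forall>u\<in>verts H. \<forall>v\<in>verts H. (u, v) \<in> (adj_rel H)\<^sup>*)"

text \<open>A cycle is a closed alternating sequence $v_0 e_0 v_1 e_1 \dots v_{l-1} e_{l-1} v_0$ of
  distinct vertices and distinct hyperedges, $l \ge 2$, with $v_i, v_{i+1} \in e_i$ (indices
  modulo $l$).\<close>

definition is_cycle :: "hgraph \<Rightarrow> nat list \<Rightarrow> nat set list \<Rightarrow> bool" where
  "is_cycle H vs es \<longleftrightarrow>
     length vs = length es \<and> length vs \<ge> 2 \<and> distinct vs \<and> distinct es \<and> set es \<subseteq> hedges H \<and>
     (\<forall>i<length vs. vs ! i \<in> es ! i \<and> vs ! (Suc i mod length vs) \<in> es ! i)"

text \<open>Two such sequences describe the same cycle (they differ only in starting point and direction)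
  iff they use the same vertex-hyperedge incidences; counting cycles means counting these sets.\<close>

definition cycle_incidences :: "nat list \<Rightarrow> nat set list \<Rightarrow> (nat \<times> nat set) set" where
  "cycle_incidences vs es =
     {(vs ! i, es ! i) | i. i < length vs} \<union> {(vs ! (Suc i mod length vs), es ! i) | i. i < length vs}"

definition unicyclic_hgraph :: "hgraph \<Rightarrow> bool" where
  "unicyclic_hgraph H \<longleftrightarrow>
     connected_hgraph H \<and> (\<exists>!C. \<exists>vs es. is_cycle H vs es \<and> C = cycle_incidences vs es)"

definition iso_hgraph :: "hgraph \<Rightarrow> hgraph \<Rightarrow> bool" where
  "iso_hgraph H G \<longleftrightarrow>
     (\<exists>f. bij_betw f (verts H) (verts G) \<and> (\<lambda>e. f ` e) ` hedges H = hedges G)"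

definition linear_unicyclic_class :: "nat \<Rightarrow> nat \<Rightarrow> hgraph set" where
  "linear_unicyclic_class k m =
     {H. wf_hgraph H \<and> uniform_hgraph k H \<and> linear_hgraph H \<and> unicyclic_hgraph H \<and>
         card (hedges H) = m}"

text \<open>In the hypercycle, $0,\dots,g-1$ are the vertices of the cycle graph $C_g$; the $k-2$ vertices
  inserted into its $i$-th edge are $g+i(k-2),\dots,g+(i+1)(k-2)-1$. Intended for $g \ge 3$ and
  $k \ge 2$.\<close>

definition hypercycle :: "nat \<Rightarrow> nat \<Rightarrow> hgraph" where
  "hypercycle k g = HGraph (g + g * (k - 2))
     ((\<lambda>i. {i, Suc i mod g} \<union> {g + i * (k - 2) ..< g + Suc i * (k - 2)}) ` {..<g})"

definition add_pendant :: "nat \<Rightarrow> nat \<Rightarrow> hgraph \<Rightarrow> hgraph" where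
  "add_pendant k v H = HGraph (nverts H + (k - 1))
     (insert (insert v {nverts H ..< nverts H + (k - 1)}) (hedges H))"

definition C3_pendant :: "nat \<Rightarrow> nat \<Rightarrow> nat \<Rightarrow> nat \<Rightarrow> hgraph" where
  "C3_pendant k n1 n2 n3 =
     (add_pendant k 2 ^^ n3) ((add_pendant k 1 ^^ n2) ((add_pendant k 0 ^^ n1) (hypercycle k 3)))"


section \<open>Tensors and their traces\<close>

text \<open>A $k$-order $n$-dimensional tensor is a function on index lists; only its values at lists of
  length $k$ with entries below $n$ matter.\<close>

type_synonym tensor = "nat list \<Rightarrow> real"

definition adjacency_tensor :: "nat \<Rightarrow> hgraph \<Rightarrow> tensor" where
  "adjacency_tensor k H is = (if set is \<in> hedges H then 1 / fact (k - 1) else 0)"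

definition degree_tensor :: "nat \<Rightarrow> hgraph \<Rightarrow> tensor" where
  "degree_tensor k H is = (if is = replicate k (hd is) then real (vdegree H (hd is)) else 0)"

definition A_alpha :: "real \<Rightarrow> nat \<Rightarrow> hgraph \<Rightarrow> tensor" where
  "A_alpha \<alpha> k H is = \<alpha> * degree_tensor k H is + (1 - \<alpha>) * adjacency_tensor k H is"

text \<open>Real polynomials in the indeterminates $a_{ij}$, as finitely supported functions from
  monomials (exponent functions) to coefficients, with the convolution product of
  \<^theory>\<open>HOL-Library.Poly_Mapping\<close>.\<close>

type_synonym apoly = "((nat \<times> nat) \<Rightarrow>\<^sub>0 nat) \<Rightarrow>\<^sub>0 real"

definition const_poly :: "real \<Rightarrow> apoly" where
  "const_poly c = Poly_Mapping.single 0 c"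

definition var_poly :: "nat \<times> nat \<Rightarrow> apoly" where
  "var_poly v = Poly_Mapping.single (Poly_Mapping.single v 1) 1"

text \<open>The formal partial derivative with respect to $v$. The monomials with exponent $0$ in $v$, for
  which the subtraction is truncated, get coefficient $0$.\<close>

definition pdiff :: "nat \<times> nat \<Rightarrow> apoly \<Rightarrow> apoly" where
  "pdiff v p = (\<Sum>x\<in>Poly_Mapping.keys p.
     Poly_Mapping.single (x - Poly_Mapping.single v 1)
       (Poly_Mapping.lookup p x * real (Poly_Mapping.lookup x v)))"

definition generic_matrix :: "nat \<Rightarrow> apoly mat" where
  "generic_matrix n = mat n n var_poly"

definition mat_tr :: "apoly mat \<Rightarrow> apoly" where
  "mat_tr M = (\<Sum>i<dim_row M. M $$ (i, i))"

text \<open>The operator $\sum_{\gamma\in[n]^{k-1}} T_{i\gamma}\,\partial/\partial a_{i\gamma}$.\<close>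

definition row_operator :: "nat \<Rightarrow> nat \<Rightarrow> tensor \<Rightarrow> nat \<Rightarrow> apoly \<Rightarrow> apoly" where
  "row_operator k n T i p =
     (\<Sum>\<gamma> | set \<gamma> \<subseteq> {..<n} \<and> length \<gamma> = k - 1.
        const_poly (T (i # \<gamma>)) * fold (\<lambda>j. pdiff (i, j)) \<gamma> p)"

text \<open>The product (composition) over all rows $i$ of
  $\frac{1}{(d_i(k-1))!}\big(\sum_\gamma T_{i\gamma}\,\partial/\partial a_{i\gamma}\big)^{d_i}$;
  the factors commute.\<close>

definition trace_operator :: "nat \<Rightarrow> nat \<Rightarrow> tensor \<Rightarrow> nat list \<Rightarrow> apoly \<Rightarrow> apoly" where
  "trace_operator k n T ds p =
     fold (\<lambda>i q. const_poly (1 / fact (ds ! i * (k - 1))) * (row_operator k n T i ^^ (ds ! i)) q)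
       [0..<n] p"

text \<open>The $d$-th order trace of a $k$-order $n$-dimensional tensor. The polynomial
  $\mathrm{tr}(A^{d(k-1)})$ is homogeneous of degree $d(k-1)$ and exactly as many derivatives are
  applied to it, so the resulting polynomial is a constant; looking up the coefficient of the
  monomial $0$ (that is, $1$) turns it into a real number.\<close>

definition Tr :: "nat \<Rightarrow> nat \<Rightarrow> nat \<Rightarrow> tensor \<Rightarrow> real" where
  "Tr k n d T =
     (if d = 0 then real (n * (k - 1) ^ (n - 1))
      else real ((k - 1) ^ (n - 1)) *
        (\<Sum>ds | length ds = n \<and> sum_list ds = d.
           Poly_Mapping.lookup
             (trace_operator k n T ds (mat_tr (generic_matrix n ^\<^sub>m (d * (k - 1))))) 0))"


section \<open>The $S_\alpha$-order\<close>

definition S_less :: "real \<Rightarrow> nat \<Rightarrow> hgraph \<Rightarrow> hgraph \<Rightarrow> bool" where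
  "S_less \<alpha> k H1 H2 \<longleftrightarrow>
     nverts H1 = nverts H2 \<and>
     (\<exists>d\<in>{1..nverts H1 * (k - 1) ^ (nverts H1 - 1) - 1}.
        (\<forall>t<d. Tr k (nverts H1) t (A_alpha \<alpha> k H1) = Tr k (nverts H2) t (A_alpha \<alpha> k H2)) \<and>
        Tr k (nverts H1) d (A_alpha \<alpha> k H1) < Tr k (nverts H2) d (A_alpha \<alpha> k H2))"

definition is_last :: "real \<Rightarrow> nat \<Rightarrow> hgraph set \<Rightarrow> hgraph \<Rightarrow> bool" where
  "is_last \<alpha> k \<C> L \<longleftrightarrow> L \<in> \<C> \<and> (\<forall>H\<in>\<C>. \<not> iso_hgraph H L \<longrightarrow> S_less \<alpha> k H L)"

definition is_second_last :: "real \<Rightarrow> nat \<Rightarrow> hgraph set \<Rightarrow> hgraph \<Rightarrow> bool" where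
  "is_second_last \<alpha> k \<C> S \<longleftrightarrow>
     (\<exists>L. is_last \<alpha> k \<C> L \<and> is_last \<alpha> k {H \<in> \<C>. \<not> iso_hgraph H L} S)"

end

(* By the trace formula, Tr_0 and Tr_1 of A_alpha depend only on k, m and the number of vertices, and
   Tr_2 is, up to quantities of this kind, a positive multiple of the sum of the squared vertex degrees.
   So it suffices to find the members of the class with the largest and second largest sum of squared
   degrees.

   Growing a linear unicyclic hypergraph along connected sets of edges shows that it has m(k-1)
   vertices. Hence the excesses d(v) - 1 sum to m, and two vertices share at most one edge, so any two
   excesses sum to at most m - 1. The two largest sums of squares are those of the excess sequences
   (m-2, 1, 1, 0, ...) and (m-3, 2, 1, 0, ...), and each of them determines the hypergraph up to
   isomorphism. *)

theory Submission
  imports Defs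
begin

section \<open>Coefficients of the trace of a power of the generic matrix\<close>

text \<open>A coefficient of \<open>tr (A^d)\<close> can be nonzero only at a monomial whose arcs
  are those of a closed walk, and this decides which derivatives survive in \<open>Tr\<close>. In
  order one only the diagonal entries, \<alpha> times the degrees, contribute. In order two a
  product of entries from two different rows survives only for k = 2, where it adds a constant per
  edge: for k \<ge> 3 a hyperedge does not fit into the two indices available.

  Order two suffices because the two extremal excess sequences are strictly separated from each
  other and from all others, so no tie is left to a higher trace. The margin is thin: when the
  largest excess is at most m - 4, two different estimates are needed.

  In the classification the cycle is never extracted from the hypergraph. The triangle emerges from
  counting: a vertex missing only one or two edges leaves so little excess that linearity dictates
  the incidences of all vertices of degree above one, and these determine the hypergraph.\<close>

abbreviation lookup :: "('a \<Rightarrow>\<^sub>0 'b::zero) \<Rightarrow> 'a \<Rightarrow> 'b" where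
  "lookup \<equiv> Poly_Mapping.lookup"

abbreviation single :: "'a \<Rightarrow> 'b::zero \<Rightarrow> 'a \<Rightarrow>\<^sub>0 'b" where
  "single \<equiv> Poly_Mapping.single"

section \<open>Coefficients under products and derivatives\<close>

lemma poly_mapping_sum_single:
  "p = (\<Sum>y\<in>Poly_Mapping.keys p. single y (lookup p y))"
  by (rule poly_mapping_eqI) (simp add: lookup_sum lookup_single when_def in_keys_iff sum.delta)

text \<open>Exponents are natural numbers, so \<open>x - single v 1\<close> truncates at 0; the
  condition \<open>lookup x v \<noteq> 0\<close> singles out a genuine division by the
  variable.\<close>

lemma add_single_eq_iff:
  fixes x y :: "'a \<Rightarrow>\<^sub>0 nat"
  shows "y + single v 1 = x \<longleftrightarrow> lookup x v \<noteq> 0 \<and> y = x - single v 1"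
proof
  assume "lookup x v \<noteq> 0 \<and> y = x - single v 1"
  then show "y + single v 1 = x"
    by (intro poly_mapping_eqI) (auto simp: lookup_add lookup_minus lookup_single when_def)
qed (auto simp: lookup_add)

lemma lookup_times_var_poly:
  "lookup (p * var_poly v) x =
    (if lookup x v = 0 then 0 else lookup p (x - single v 1))"
proof -
  have "p * var_poly v = (\<Sum>y\<in>Poly_Mapping.keys p. single (y + single v 1) (lookup p y))"
    by (subst (1) poly_mapping_sum_single[of p]) (simp add: sum_distrib_right var_poly_def mult_single)
  then have "lookup (p * var_poly v) x =
      (\<Sum>y\<in>Poly_Mapping.keys p. if y + single v 1 = x then lookup p y else 0)"
    by (simp add: lookup_sum lookup_single when_def)
  then show ?thesis
    by (cases "lookup x v = 0")
      (simp_all add: add_single_eq_iff sum.delta in_keys_iff del: One_nat_def)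
qed

lemma lookup_const_poly_times [simp]: "lookup (const_poly c * p) x = c * lookup p x"
proof -
  have "const_poly c * p = (\<Sum>y\<in>Poly_Mapping.keys p. single y (c * lookup p y))"
    by (subst (1) poly_mapping_sum_single[of p]) (simp add: sum_distrib_left const_poly_def mult_single)
  then have "lookup (const_poly c * p) x =
      (\<Sum>y\<in>Poly_Mapping.keys p. if y = x then c * lookup p y else 0)"
    by (simp add: lookup_sum lookup_single when_def)
  then show ?thesis
    by (auto simp: sum.delta in_keys_iff)
qed

text \<open>Read at one coefficient, differentiation is an upward shift of the monomial and needs no
  case for exponent 0. The factor is the exponent of \<open>v\<close> before differentiating, one
  more than after.\<close>

lemma lookup_pdiff:
  "lookup (pdiff v p) x = lookup p (x + single v 1) * real (Suc (lookup x v))"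
proof -
  have "lookup (pdiff v p) x =
      (\<Sum>y\<in>Poly_Mapping.keys p. if y = x + single v 1 then lookup p y * real (lookup y v) else 0)"
  proof -
    \<comment> \<open>Truncation may send two monomials to the same x, but one with exponent 0 in
      \<open>v\<close> carries the factor 0.\<close>
    have "y = x + single v 1" if "y - single v 1 = x" "lookup y v \<noteq> 0" for y
      using that add_single_eq_iff[of x v y] by auto
    then show ?thesis
      unfolding pdiff_def lookup_sum lookup_single when_def
      by (intro sum.cong) auto
  qed
  then show ?thesis
    by (auto simp: sum.delta in_keys_iff lookup_add)
qed

text \<open>The monomial that the index list \<gamma> differentiates away in row i. Seen as arcs,
  all its variables leave i.\<close>

definition row_monom :: "nat \<Rightarrow> nat list \<Rightarrow> (nat \<times> nat) \<Rightarrow>\<^sub>0 nat" where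
  "row_monom i \<gamma> = (\<Sum>j\<leftarrow>\<gamma>. single (i, j) 1)"

lemma row_monom_simps [simp]:
  "row_monom i [] = 0" "row_monom i (j # \<gamma>) = single (i, j) 1 + row_monom i \<gamma>"
  by (simp_all add: row_monom_def)

lemma lookup_row_monom_nonzero:
  "lookup (row_monom i \<gamma>) (a, b) \<noteq> 0 \<longleftrightarrow> a = i \<and> b \<in> set \<gamma>"
  by (induction \<gamma>) (auto simp: lookup_add lookup_single when_def)

text \<open>Each derivative only multiplies the shifted coefficient by a number, whose value does
  not matter when that coefficient is 0. This disposes of the terms without a closed walk.\<close>

lemma lookup_fold_pdiff_eq_0:
  "lookup p (x + row_monom i \<gamma>) = 0 \<Longrightarrow> lookup (fold (\<lambda>j. pdiff (i, j)) \<gamma> p) x = 0"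
  by (induction \<gamma> arbitrary: p) (simp_all add: lookup_pdiff ac_simps)

text \<open>The factors s + 1, ..., s + r of the iterated shift multiply to a quotient of
  factorials, which later cancels the normalisation in \<open>trace_operator\<close>.\<close>

lemma lookup_funpow_pdiff:
  "lookup ((pdiff v ^^ r) p) (single v s) = fact (s + r) / fact s * lookup p (single v (s + r))"
proof (induction r arbitrary: s)
  case (Suc r)
  have "single v s + single v 1 = single v (Suc s)"
    by (simp flip: single_add)
  then show ?case
    by (simp add: Suc.IH lookup_pdiff field_simps del: of_nat_Suc)
qed simp

lemma finite_index_lists: "finite {\<gamma>. set \<gamma> \<subseteq> {..<n::nat} \<and> length \<gamma> = r}"
  by (simp add: finite_lists_length_eq)

lemma lookup_row_operator:
  "lookup (row_operator k n T i p) x =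
    (\<Sum>\<gamma> | set \<gamma> \<subseteq> {..<n} \<and> length \<gamma> = k - 1.
       T (i # \<gamma>) * lookup (fold (\<lambda>j. pdiff (i, j)) \<gamma> p) x)"
  by (simp add: row_operator_def lookup_sum)

lemma lookup_row_operator_eq_0:
  assumes "\<And>\<gamma>. set \<gamma> \<subseteq> {..<n} \<Longrightarrow> length \<gamma> = k - 1 \<Longrightarrow> T (i # \<gamma>) \<noteq> 0 \<Longrightarrow>
    lookup p (x + row_monom i \<gamma>) = 0"
  shows "lookup (row_operator k n T i p) x = 0"
  unfolding lookup_row_operator
proof (rule sum.neutral, intro ballI)
  fix \<gamma> assume "\<gamma> \<in> {\<gamma>. set \<gamma> \<subseteq> {..<n} \<and> length \<gamma> = k - 1}"
  then show "T (i # \<gamma>) * lookup (fold (\<lambda>j. pdiff (i, j)) \<gamma> p) x = 0"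
    using assms[of \<gamma>] lookup_fold_pdiff_eq_0[of p x i \<gamma>] by auto
qed

lemma lookup_row_operator_loop:
  assumes "i < n" "k \<ge> 1"
    and "\<And>\<gamma>. set \<gamma> \<subseteq> {..<n} \<Longrightarrow> length \<gamma> = k - 1 \<Longrightarrow> \<gamma> \<noteq> replicate (k - 1) i \<Longrightarrow>
      lookup p (single (i, i) s + row_monom i \<gamma>) = 0"
  shows "lookup (row_operator k n T i p) (single (i, i) s) =
    T (replicate k i) * (fact (s + (k - 1)) / fact s) * lookup p (single (i, i) (s + (k - 1)))"
proof -
  let ?G = "{\<gamma>. set \<gamma> \<subseteq> {..<n} \<and> length \<gamma> = k - 1}" and ?r = "replicate (k - 1) i"
  have "?r \<in> ?G"
    using assms(1) by auto
  moreover have "lookup (fold (\<lambda>j. pdiff (i, j)) \<gamma> p) (single (i, i) s) = 0" if "\<gamma> \<in> ?G - {?r}" for \<gamma>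
    using that assms(3)[of \<gamma>] by (intro lookup_fold_pdiff_eq_0) auto
  ultimately have "lookup (row_operator k n T i p) (single (i, i) s) =
      T (i # ?r) * lookup (fold (\<lambda>j. pdiff (i, j)) ?r p) (single (i, i) s)"
    unfolding lookup_row_operator using finite_index_lists
    by (subst sum.remove[of _ ?r]) auto
  moreover have "i # ?r = replicate k i"
    using assms(2) by (cases k) auto
  ultimately show ?thesis
    by (simp add: lookup_funpow_pdiff)
qed

section \<open>Walks behind the coefficients of matrix powers\<close>

lemma generic_matrix_carrier: "generic_matrix n \<in> carrier_mat n n"
  by (simp add: generic_matrix_def)

lemma lookup_generic_matrix_pow_Suc:
  assumes "i < n" "j < n"
  shows "lookup ((generic_matrix n ^\<^sub>m Suc d) $$ (i, j)) x =
    (\<Sum>l<n. if lookup x (l, j) = 0 then 0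
       else lookup ((generic_matrix n ^\<^sub>m d) $$ (i, l)) (x - single (l, j) 1))"
proof -
  have c: "generic_matrix n ^\<^sub>m d \<in> carrier_mat n n"
    by (simp add: generic_matrix_carrier pow_carrier_mat)
  then have "(generic_matrix n ^\<^sub>m Suc d) $$ (i, j) =
      (\<Sum>l<n. (generic_matrix n ^\<^sub>m d) $$ (i, l) * var_poly (l, j))"
    using assms by (auto simp: times_mat_def scalar_prod_def generic_matrix_def atLeast0LessThan
        intro!: sum.cong)
  then show ?thesis
    by (simp add: lookup_sum lookup_times_var_poly)
qed

text \<open>An entry of the power sums the arc monomials of the walks of length d from i to j. Only
  the set of arcs is recorded, not their multiplicities; this is enough to show that coefficients
  vanish.\<close>

lemma lookup_generic_matrix_pow_nonzero_walk:
  assumes "i < n" "j < n" "lookup ((generic_matrix n ^\<^sub>m d) $$ (i, j)) x \<noteq> 0"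
  shows "\<exists>w. w 0 = i \<and> w d = j \<and> (\<forall>v. lookup x v \<noteq> 0 \<longleftrightarrow> (\<exists>t<d. v = (w t, w (Suc t))))"
  using assms(2,3)
proof (induction d arbitrary: j x)
  case 0
  then have "i = j \<and> x = 0"
    using assms(1) by (auto simp: generic_matrix_def one_mat_def lookup_one split: if_splits)
  then show ?case
    by (intro exI[of _ "\<lambda>_. i"]) simp
next
  case (Suc d)
  let ?g = "\<lambda>l. if lookup x (l, j) = 0 then 0
      else lookup ((generic_matrix n ^\<^sub>m d) $$ (i, l)) (x - single (l, j) 1)"
  have "sum ?g {..<n} \<noteq> 0"
    using Suc.prems(2) lookup_generic_matrix_pow_Suc[OF assms(1) Suc.prems(1), of d x] by argo
  then obtain l where "l \<in> {..<n}" "?g l \<noteq> 0"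
    by (rule sum.not_neutral_contains_not_neutral)
  then have l: "l < n" "lookup x (l, j) \<noteq> 0"
      "lookup ((generic_matrix n ^\<^sub>m d) $$ (i, l)) (x - single (l, j) 1) \<noteq> 0"
    by (simp, metis, metis)
  define y where "y = x - single (l, j) 1"
  from Suc.IH[OF l(1,3)] obtain w where w: "w 0 = i" "w d = l"
      "\<And>v. lookup y v \<noteq> 0 \<longleftrightarrow> (\<exists>t<d. v = (w t, w (Suc t)))"
    unfolding y_def by blast
  let ?w = "w(Suc d := j)"
  have x: "x = y + single (l, j) 1"
    using add_single_eq_iff[of y "(l, j)" x] l(2) y_def by metis
  have "lookup x v \<noteq> 0 \<longleftrightarrow> (\<exists>t<Suc d. v = (?w t, ?w (Suc t)))" for v
  proof -
    have "lookup x v \<noteq> 0 \<longleftrightarrow> lookup y v \<noteq> 0 \<or> v = (l, j)"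
      unfolding x by (auto simp: lookup_add lookup_single when_def)
    also have "\<dots> \<longleftrightarrow> (\<exists>t<d. v = (?w t, ?w (Suc t))) \<or> v = (?w d, ?w (Suc d))"
      using w(2) unfolding w(3) by (intro arg_cong2[where f = "(\<or>)"] ex_cong1) auto
    also have "\<dots> \<longleftrightarrow> (\<exists>t<Suc d. v = (?w t, ?w (Suc t)))"
      by (metis less_Suc_eq)
    finally show ?thesis .
  qed
  then show ?case
    using w(1) by (intro exI[of _ ?w]) auto
qed

lemma lookup_mat_tr_pow:
  "lookup (mat_tr (generic_matrix n ^\<^sub>m d)) x = (\<Sum>i<n. lookup ((generic_matrix n ^\<^sub>m d) $$ (i, i)) x)"
proof -
  have "dim_row (generic_matrix n ^\<^sub>m d) = n"
    using pow_carrier_mat[OF generic_matrix_carrier] by (rule carrier_matD)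
  then show ?thesis
    by (simp only: mat_tr_def lookup_sum)
qed

lemma lookup_mat_tr_nonzero_walk:
  assumes "lookup (mat_tr (generic_matrix n ^\<^sub>m d)) x \<noteq> 0"
  obtains w where "w d = w 0" "\<And>v. lookup x v \<noteq> 0 \<longleftrightarrow> (\<exists>t<d. v = (w t, w (Suc t)))"
proof -
  from assms obtain i where "i < n" "lookup ((generic_matrix n ^\<^sub>m d) $$ (i, i)) x \<noteq> 0"
    unfolding lookup_mat_tr_pow by (metis (no_types, lifting) lessThan_iff sum.neutral)
  from lookup_generic_matrix_pow_nonzero_walk[OF this(1) this] show thesis
    using that by auto
qed

text \<open>A closed walk both enters and leaves each of its vertices.\<close>

lemma lookup_mat_tr_nonzero_head_tail:
  assumes "lookup (mat_tr (generic_matrix n ^\<^sub>m d)) x \<noteq> 0"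
  shows "lookup x (a, b) \<noteq> 0 \<Longrightarrow> \<exists>c. lookup x (b, c) \<noteq> 0"
    and "lookup x (a, b) \<noteq> 0 \<Longrightarrow> \<exists>c. lookup x (c, a) \<noteq> 0"
proof -
  from lookup_mat_tr_nonzero_walk[OF assms] obtain w where
    w: "w d = w 0" "\<And>v. lookup x v \<noteq> 0 \<longleftrightarrow> (\<exists>t<d. v = (w t, w (Suc t)))"
    by blast
  assume "lookup x (a, b) \<noteq> 0"
  then obtain t where t: "t < d" "a = w t" "b = w (Suc t)"
    unfolding w(2) by auto
  \<comment> \<open>After its last arc the closed walk is back at \<open>w 0\<close>, the tail of
    arc number 0.\<close>
  have "\<exists>t'<d. w (Suc t) = w t'"
    using t w(1) by (cases "Suc t < d", blast) (metis Suc_lessI gr_zeroI not_less_zero)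
  then show "\<exists>c. lookup x (b, c) \<noteq> 0"
    unfolding w(2) t(3) by blast
  have "\<exists>t'<d. w t = w (Suc t')"
  proof (cases t)
    case 0
    then show ?thesis
      using t w(1) by (intro exI[of _ "d - 1"]) auto
  next
    case (Suc s)
    then show ?thesis
      using t(1) by (intro exI[of _ s]) auto
  qed
  then show "\<exists>c. lookup x (c, a) \<noteq> 0"
    unfolding w(2) t(2) by blast
qed

text \<open>A walk along loops never moves, so loops at two different vertices cannot occur
  together.\<close>

lemma lookup_mat_tr_nonzero_loops:
  assumes "lookup (mat_tr (generic_matrix n ^\<^sub>m d)) x \<noteq> 0"
    and "\<And>a b. lookup x (a, b) \<noteq> 0 \<Longrightarrow> a = b"
    and "lookup x (a, a) \<noteq> 0" "lookup x (b, b) \<noteq> 0"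
  shows "a = b"
proof -
  from lookup_mat_tr_nonzero_walk[OF assms(1)] obtain w where
    w: "w d = w 0" "\<And>v. lookup x v \<noteq> 0 \<longleftrightarrow> (\<exists>t<d. v = (w t, w (Suc t)))"
    by blast
  have "w t = w 0" if "t \<le> d" for t
    using that
  proof (induction t)
    case (Suc t)
    then show ?case
      using w(2)[of "(w t, w (Suc t))"] assms(2)[of "w t" "w (Suc t)"] by (metis Suc_le_lessD less_imp_le)
  qed simp
  moreover obtain t t' where "t < d" "a = w t" "t' < d" "b = w t'"
    using assms(3,4) unfolding w(2) by blast
  ultimately show ?thesis
    by (metis less_imp_le)
qed

lemma lookup_generic_matrix_pow_loop:
  "i < n \<Longrightarrow> lookup ((generic_matrix n ^\<^sub>m d) $$ (i, i)) (single (i, i) d) = 1"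
proof (induction d)
  case (Suc d)
  have "single (i, i) (Suc d) - single (i, i) 1 = single (i, i) d"
    by (simp flip: single_diff)
  with Suc show ?case
    unfolding lookup_generic_matrix_pow_Suc[OF Suc.prems Suc.prems]
    by (subst sum.remove[of _ i]) (auto simp: lookup_single when_def intro!: sum.neutral)
qed (simp add: generic_matrix_def)

lemma lookup_mat_tr_loop:
  assumes "i < n" "d \<ge> 1"
  shows "lookup (mat_tr (generic_matrix n ^\<^sub>m d)) (single (i, i) d) = 1"
proof -
  have "lookup ((generic_matrix n ^\<^sub>m d) $$ (j, j)) (single (i, i) d) = 0" if "j < n" "j \<noteq> i" for j
  proof (rule ccontr)
    assume "\<not> ?thesis"
    from lookup_generic_matrix_pow_nonzero_walk[OF that(1,1) this] obtain w where
      w: "w 0 = j" "\<And>v. lookup (single (i, i) d) v \<noteq> 0 \<longleftrightarrow> (\<exists>t<d. v = (w t, w (Suc t)))"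
      by blast
    \<comment> \<open>The walk has a first arc as \<open>d \<ge> 1\<close>; it leaves j and so is
      not the loop at i.\<close>
    have "lookup (single (i, i) d) (w 0, w (Suc 0)) \<noteq> 0"
      unfolding w(2) using assms(2) by (intro exI[of _ 0]) simp
    then show False
      using that(2) w(1) by (simp add: lookup_single when_def split: if_splits)
  qed
  then show ?thesis
    unfolding lookup_mat_tr_pow using assms(1) lookup_generic_matrix_pow_loop[OF assms(1)]
    by (subst sum.remove[of _ i]) auto
qed

section \<open>The first two traces of a tensor\<close>

definition unit_list :: "nat \<Rightarrow> nat \<Rightarrow> nat list" where
  "unit_list n i = map (\<lambda>l. of_bool (l = i)) [0..<n]"

text \<open>The case i = j is included and gives the value 2 at i: two applications of the same row
  operator.\<close>

definition pair_list :: "nat \<Rightarrow> nat \<Rightarrow> nat \<Rightarrow> nat list" where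
  "pair_list n i j = map (\<lambda>l. of_bool (l = i) + of_bool (l = j)) [0..<n]"

text \<open>A list with positive sum has a positive entry, which can be lowered by one. The union is
  not disjoint; repetitions are handled by the injectivity of \<open>unit_list\<close> and of
  \<open>pair_list\<close> on ordered pairs.\<close>

lemma lists_sum_Suc:
  "{ds. length ds = n \<and> sum_list ds = Suc s} =
    (\<Union>i<n. (\<lambda>ds. ds[i := Suc (ds ! i)]) ` {ds. length ds = n \<and> sum_list ds = s})"
proof (intro equalityI subsetI)
  fix ds assume "ds \<in> {ds. length ds = n \<and> sum_list ds = Suc s}"
  then have ds: "length ds = n" "sum_list ds = Suc s"
    by auto
  then have "\<not> (\<forall>x\<in>set ds. x = 0)"
    by (auto simp flip: sum_list_eq_0_iff)
  then obtain i where i: "i < n" "ds ! i \<noteq> 0"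
    using ds(1) by (auto simp: in_set_conv_nth)
  let ?es = "ds[i := ds ! i - 1]"
  have "sum_list ds \<ge> ds ! i"
    using ds(1) i(1) by (simp add: member_le_sum_list)
  then have "?es \<in> {ds. length ds = n \<and> sum_list ds = s}"
    using ds i by (simp add: sum_list_update)
  moreover have "ds = ?es[i := Suc (?es ! i)]"
    using ds i by simp
  ultimately show "ds \<in> (\<Union>i<n. (\<lambda>ds. ds[i := Suc (ds ! i)]) ` {ds. length ds = n \<and> sum_list ds = s})"
    using i(1) by blast
qed (auto simp: sum_list_update)

lemma lists_sum_1: "{ds. length ds = n \<and> sum_list ds = 1} = unit_list n ` {..<n}"
proof -
  have z: "{ds. length ds = n \<and> sum_list ds = 0} = {replicate n (0::nat)}"
    using replicate_length_same by (fastforce simp: sum_list_replicate)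
  have u: "(replicate n 0)[i := Suc (replicate n 0 ! i)] = unit_list n i" if "i < n" for i
    using that by (intro nth_equalityI) (auto simp: unit_list_def nth_list_update)
  have "{ds. length ds = n \<and> sum_list ds = 1} =
      (\<Union>i<n. (\<lambda>ds. ds[i := Suc (ds ! i)]) ` {replicate n 0})"
    by (simp only: One_nat_def lists_sum_Suc z)
  also have "\<dots> = (\<Union>i<n. {unit_list n i})"
    using u by simp
  also have "\<dots> = unit_list n ` {..<n}"
    by blast
  finally show ?thesis .
qed

lemma pair_list_commute: "pair_list n i j = pair_list n j i"
  by (simp add: pair_list_def add.commute)

lemma lists_sum_2:
  "{ds. length ds = n \<and> sum_list ds = 2} = (\<lambda>(i, j). pair_list n i j) ` {(i, j). i \<le> j \<and> j < n}"
proof -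
  have "(unit_list n j)[i := Suc (unit_list n j ! i)] = pair_list n i j" if "i < n" "j < n" for i j
    using that by (intro nth_equalityI) (auto simp: unit_list_def pair_list_def nth_list_update)
  then have "(\<Union>i<n. \<Union>j<n. {(unit_list n j)[i := Suc (unit_list n j ! i)]}) =
      (\<Union>i<n. \<Union>j<n. {pair_list n i j})"
    by simp
  moreover have "{ds. length ds = n \<and> sum_list ds = 2} =
      (\<Union>i<n. \<Union>j<n. {(unit_list n j)[i := Suc (unit_list n j ! i)]})"
    unfolding Suc_1[symmetric] lists_sum_Suc[of n 1] lists_sum_1 by blast
  ultimately have "{ds. length ds = n \<and> sum_list ds = 2} = (\<Union>i<n. \<Union>j<n. {pair_list n i j})"
    by simp
  also have "\<dots> = (\<lambda>(i, j). pair_list n i j) ` {(i, j). i \<le> j \<and> j < n}"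
  proof (intro equalityI subsetI)
    fix x assume "x \<in> (\<Union>i<n. \<Union>j<n. {pair_list n i j})"
    then obtain i j where "i < n" "j < n" "x = pair_list n i j"
      by auto
    \<comment> \<open>Sorting the two indices picks one representative of each unordered
      pair.\<close>
    then have "x = (\<lambda>(i, j). pair_list n i j) (min i j, max i j)" "(min i j, max i j) \<in> {(i, j). i \<le> j \<and> j < n}"
      using pair_list_commute[of n i j] by (auto simp: min_def max_def)
    then show "x \<in> (\<lambda>(i, j). pair_list n i j) ` {(i, j). i \<le> j \<and> j < n}"
      by blast
  qed auto
  finally show ?thesis .
qed

lemma inj_on_unit_list: "inj_on (unit_list n) {..<n}"
  by (auto simp: inj_on_def unit_list_def list_eq_iff_nth_eq)

lemma inj_on_pair_list: "inj_on (\<lambda>(i, j). pair_list n i j) {(i, j). i \<le> j \<and> j < n}"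
proof (rule inj_onI, clarify)
  fix i j i' j' assume *: "i \<le> j" "j < n" "i' \<le> j'" "j' < n" "pair_list n i j = pair_list n i' j'"
  have e: "of_bool (l = i) + of_bool (l = j) = (of_bool (l = i') + of_bool (l = j') :: nat)" if "l < n" for l
    using arg_cong[OF *(5), of "\<lambda>xs. xs ! l"] that by (simp add: pair_list_def)
  have "l = i \<or> l = j \<longleftrightarrow> l = i' \<or> l = j'" if "l < n" for l
    using e[OF that] by (auto simp: of_bool_def split: if_splits)
  from this[of i] this[of j] this[of i'] this[of j'] *(1-4) show "i = i' \<and> j = j'"
    by (smt (verit) le_antisym le_less_trans)
qed

section \<open>Row operators applied to traces of powers\<close>

lemma const_poly_1 [simp]: "const_poly 1 = 1"
  by (simp add: const_poly_def)

text \<open>A row with \<open>ds ! i = 0\<close> contributes the identity, its factor being 1 / 0!.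
  Sortedness makes the remaining rows appear in the same order as in \<open>[0..<n]\<close>.\<close>

lemma trace_operator_restrict:
  assumes "sorted xs" "distinct xs" "set xs \<subseteq> {..<n}" "\<And>i. i < n \<Longrightarrow> i \<notin> set xs \<Longrightarrow> ds ! i = 0"
  shows "trace_operator k n T ds p = fold (\<lambda>i q. const_poly (1 / fact (ds ! i * (k - 1))) *
      (row_operator k n T i ^^ (ds ! i)) q) xs p"
proof -
  let ?f = "\<lambda>i q. const_poly (1 / fact (ds ! i * (k - 1))) * (row_operator k n T i ^^ (ds ! i)) q"
  have f: "fold ?f ys q = fold ?f (filter (\<lambda>i. ds ! i \<noteq> 0) ys) q" for ys q
    by (induction ys arbitrary: q) auto
  have g: "filter (\<lambda>i. ds ! i \<noteq> 0) xs = filter (\<lambda>i. ds ! i \<noteq> 0) [0..<n]"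
  proof (rule sorted_distinct_set_unique)
    show "set (filter (\<lambda>i. ds ! i \<noteq> 0) xs) = set (filter (\<lambda>i. ds ! i \<noteq> 0) [0..<n])"
      using assms(3,4) by fastforce
  qed (simp_all add: assms(1,2) sorted_wrt_filter)
  show ?thesis
    by (simp only: trace_operator_def f[of xs] f[of "[0..<n]"] g)
qed

lemma trace_operator_unit:
  assumes "i < n"
  shows "trace_operator k n T (unit_list n i) p = const_poly (1 / fact (k - 1)) * row_operator k n T i p"
  using assms by (subst trace_operator_restrict[of "[i]"]) (auto simp: unit_list_def)

lemma trace_operator_pair_same:
  assumes "i < n"
  shows "trace_operator k n T (pair_list n i i) p =
    const_poly (1 / fact (2 * (k - 1))) * row_operator k n T i (row_operator k n T i p)"
  using assms by (subst trace_operator_restrict[of "[i]"]) (auto simp: pair_list_def numeral_2_eq_2)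

lemma trace_operator_pair:
  assumes "i < j" "j < n"
  shows "trace_operator k n T (pair_list n i j) p = const_poly (1 / fact (k - 1)) *
    row_operator k n T j (const_poly (1 / fact (k - 1)) * row_operator k n T i p)"
  using assms by (subst trace_operator_restrict[of "[i, j]"]) (auto simp: pair_list_def)

text \<open>All arcs of this monomial leave i. In a closed walk every head is also a tail, hence
  equal to i, and \<gamma> would be constant.\<close>

lemma lookup_mat_tr_row_monom_eq_0:
  assumes "length \<gamma> = r" "\<gamma> \<noteq> replicate r i" "\<And>a b. lookup x (a, b) \<noteq> 0 \<Longrightarrow> a = i"
  shows "lookup (mat_tr (generic_matrix n ^\<^sub>m d)) (x + row_monom i \<gamma>) = 0"
proof (rule ccontr)
  assume nz: "\<not> ?thesis"
  have tail: "a = i" if "lookup (x + row_monom i \<gamma>) (a, b) \<noteq> 0" for a b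
    using that assms(3)[of a b] lookup_row_monom_nonzero[of i \<gamma> a b] by (auto simp: lookup_add)
  have "l = i" if "l \<in> set \<gamma>" for l
  proof -
    have "lookup (x + row_monom i \<gamma>) (i, l) \<noteq> 0"
      using that lookup_row_monom_nonzero[of i \<gamma> i l] by (simp add: lookup_add)
    then show ?thesis
      using lookup_mat_tr_nonzero_head_tail(1)[OF nz] tail by blast
  qed
  then have "\<gamma> = replicate r i"
    using assms(1) by (intro replicate_eqI) auto
  then show False
    using assms(2) by simp
qed

lemma Tr_1:
  assumes "k \<ge> 2"
  shows "Tr k n 1 T = real ((k - 1) ^ (n - 1)) * (\<Sum>i<n. T (replicate k i))"
proof -
  let ?p = "mat_tr (generic_matrix n ^\<^sub>m (k - 1))"
  have "lookup (trace_operator k n T (unit_list n i) ?p) 0 = T (replicate k i)" if "i < n" for i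
  proof -
    have "lookup ?p (single (i, i) 0 + row_monom i \<gamma>) = 0"
      if "length \<gamma> = k - 1" "\<gamma> \<noteq> replicate (k - 1) i" for \<gamma>
      using that by (intro lookup_mat_tr_row_monom_eq_0) auto
    with lookup_row_operator_loop[of i n k ?p 0 T] \<open>i < n\<close> assms
    have "lookup (row_operator k n T i ?p) 0 = T (replicate k i) * fact (k - 1)"
      by (simp add: lookup_mat_tr_loop)
    then show ?thesis
      using \<open>i < n\<close> by (simp add: trace_operator_unit)
  qed
  then show ?thesis
    unfolding Tr_def lists_sum_1 by (simp add: sum.reindex inj_on_unit_list)
qed

text \<open>Two batches of k - 1 derivatives of the loop monomial produce (2(k-1))! / (k-1)! and
  then (k-1)!; the product is exactly the normalising factorial.\<close>

lemma lookup_trace_operator_pair_same: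
  assumes "k \<ge> 2" "i < n"
  shows "lookup (trace_operator k n T (pair_list n i i) (mat_tr (generic_matrix n ^\<^sub>m (2 * (k - 1))))) 0 =
    (T (replicate k i))\<^sup>2"
proof -
  let ?p = "mat_tr (generic_matrix n ^\<^sub>m (2 * (k - 1)))"
  have "lookup ?p (single (i, i) (k - 1) + row_monom i \<gamma>) = 0"
    if "length \<gamma> = k - 1" "\<gamma> \<noteq> replicate (k - 1) i" for \<gamma>
    using that by (intro lookup_mat_tr_row_monom_eq_0) (auto simp: lookup_single when_def split: if_splits)
  with lookup_row_operator_loop[of i n k ?p "k - 1" T] assms
  have 1: "lookup (row_operator k n T i ?p) (single (i, i) (k - 1)) =
      T (replicate k i) * (fact (2 * (k - 1)) / fact (k - 1))"
    by (simp add: lookup_mat_tr_loop flip: mult_2)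
  \<comment> \<open>A stray arc in one batch cannot be repaired by the other, since all arcs of both
    still leave i.\<close>
  have "lookup (row_operator k n T i ?p) (single (i, i) 0 + row_monom i \<gamma>) = 0"
    if "length \<gamma> = k - 1" "\<gamma> \<noteq> replicate (k - 1) i" for \<gamma>
  proof (rule lookup_row_operator_eq_0)
    fix \<gamma>' :: "nat list"
    show "lookup ?p (single (i, i) 0 + row_monom i \<gamma> + row_monom i \<gamma>') = 0"
      using that lookup_mat_tr_row_monom_eq_0[of \<gamma> "k - 1" i "row_monom i \<gamma>'" n "2 * (k - 1)"]
        lookup_row_monom_nonzero[of i \<gamma>'] by (simp add: add.commute)
  qed
  with lookup_row_operator_loop[of i n k "row_operator k n T i ?p" 0 T] assms 1
  show ?thesis
    by (simp add: trace_operator_pair_same power2_eq_square)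
qed

text \<open>In a closed walk whose arcs leave i or j, all heads are i or j too. An index tuple with
  at most two values, fewer than k, is diagonal by \<open>supp\<close>; so only loops at i and at j
  remain, and these do not form one walk.\<close>

lemma lookup_trace_operator_pair_eq_0:
  assumes "k \<ge> 3" "i < j" "j < n"
    and supp: "\<And>is. length is = k \<Longrightarrow> T is \<noteq> 0 \<Longrightarrow> is = replicate k (hd is) \<or> card (set is) = k"
  shows "lookup (trace_operator k n T (pair_list n i j) (mat_tr (generic_matrix n ^\<^sub>m (2 * (k - 1))))) 0 = 0"
proof -
  let ?p = "mat_tr (generic_matrix n ^\<^sub>m (2 * (k - 1)))"
  have "lookup ?p (row_monom j \<delta> + row_monom i \<gamma>) = 0"
    if \<delta>: "length \<delta> = k - 1" "T (j # \<delta>) \<noteq> 0" and \<gamma>: "length \<gamma> = k - 1" "T (i # \<gamma>) \<noteq> 0" for \<gamma> \<delta>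
  proof (rule ccontr)
    let ?x = "row_monom j \<delta> + row_monom i \<gamma>"
    assume nz: "lookup ?p ?x \<noteq> 0"
    have x: "lookup ?x (a, b) \<noteq> 0 \<longleftrightarrow> a = j \<and> b \<in> set \<delta> \<or> a = i \<and> b \<in> set \<gamma>" for a b
      using lookup_row_monom_nonzero[of j \<delta> a b] lookup_row_monom_nonzero[of i \<gamma> a b]
      by (auto simp: lookup_add)
    have heads: "b = i \<or> b = j" if "b \<in> set \<delta> \<union> set \<gamma>" for b
      using that lookup_mat_tr_nonzero_head_tail(1)[OF nz] unfolding x by blast
    have const: "set \<eta> = {a}" if "length \<eta> = k - 1" "T (a # \<eta>) \<noteq> 0" "a \<in> {i, j}" "set \<eta> \<subseteq> {i, j}" for a \<eta>
    proof -
      have "card (set (a # \<eta>)) \<le> card {i, j}"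
        using that(3,4) by (intro card_mono) auto
      also have "\<dots> < k"
        using assms(1) by (auto intro: le_less_trans[OF card_insert_le_m1])
      finally have "a # \<eta> = replicate k (hd (a # \<eta>))"
        using supp[of "a # \<eta>"] that(1,2) assms(1) by auto
      then have "a # \<eta> = replicate k a"
        by simp
      then have "\<eta> = replicate (k - 1) a"
        by (cases k) auto
      then show ?thesis
        using assms(1) by simp
    qed
    have "set \<delta> = {j}" "set \<gamma> = {i}"
      using const[of \<delta> j] const[of \<gamma> i] \<delta> \<gamma> heads by auto
    then have x': "lookup ?x (a, b) \<noteq> 0 \<longleftrightarrow> a = b \<and> (a = j \<or> a = i)" for a b
      unfolding x by auto
    have "i = j"
      by (rule lookup_mat_tr_nonzero_loops[OF nz]) (simp_all only: x', simp_all)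
    then show False
      using assms(2) by simp
  qed
  then have "lookup (row_operator k n T j (const_poly (1 / fact (k - 1)) * row_operator k n T i ?p)) 0 = 0"
    by (intro lookup_row_operator_eq_0) (simp add: lookup_row_operator_eq_0)
  then show ?thesis
    using assms by (simp add: trace_operator_pair)
qed

lemma lookup_row_operator_2:
  "lookup (row_operator 2 n T i p) x =
    (\<Sum>l<n. T [i, l] * (lookup p (x + single (i, l) 1) * real (Suc (lookup x (i, l)))))"
proof -
  have "{\<gamma>. set \<gamma> \<subseteq> {..<n} \<and> length \<gamma> = 2 - 1} = (\<lambda>l. [l]) ` {..<n}"
    by (auto simp: length_Suc_conv)
  then show ?thesis
    by (simp add: lookup_row_operator sum.reindex inj_on_def lookup_pdiff)
qed

lemma single_1_eq_iff: "single a (1::nat) = single b 1 \<longleftrightarrow> a = b"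
  by (metis lookup_single_eq lookup_single_not_eq zero_neq_one)

text \<open>The trace of the square contains \<open>a_ij * a_ji\<close> twice, once for each
  starting vertex, and no other product of an arc leaving i with an arc leaving j.\<close>

lemma lookup_mat_tr_generic_matrix_sq:
  assumes "i < n" "j < n" "i \<noteq> j"
  shows "lookup (mat_tr (generic_matrix n ^\<^sub>m 2)) (single (j, l') 1 + single (i, l) 1) =
    2 * of_bool (l' = i \<and> l = j)"
proof (cases "l' = i \<and> l = j")
  case False
  let ?x = "single (j, l') 1 + single (i, l) (1::nat)"
  have x: "lookup ?x (a, b) \<noteq> 0 \<longleftrightarrow> a = j \<and> b = l' \<or> a = i \<and> b = l" for a b
    by (auto simp: lookup_add lookup_single when_def)
  have "lookup (mat_tr (generic_matrix n ^\<^sub>m 2)) ?x = 0"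
  proof (rule ccontr)
    assume nz: "\<not> ?thesis"
    have "l \<in> {i, j}" "l' \<in> {i, j}" "i \<in> {l, l'}" "j \<in> {l, l'}"
      using lookup_mat_tr_nonzero_head_tail[OF nz] unfolding x by blast+
    then have "l = i" "l' = j"
      using False assms(3) by auto
    then have x': "lookup ?x (a, b) \<noteq> 0 \<longleftrightarrow> a = b \<and> (a = j \<or> a = i)" for a b
      unfolding x by auto
    have "i = j"
      by (rule lookup_mat_tr_nonzero_loops[OF nz]) (simp_all only: x', simp_all)
    then show False
      using assms(3) by simp
  qed
  then show ?thesis
    using False by simp
next
  case True
  let ?x = "single (j, i) 1 + single (i, j) (1::nat)"
  have "lookup ((generic_matrix n ^\<^sub>m 2) $$ (a, a)) ?x = of_bool (a = i \<or> a = j)" if "a < n" for a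
  proof -
    have 0: "generic_matrix n ^\<^sub>m 1 = generic_matrix n"
      using generic_matrix_carrier by simp
    have d: "?x - single (i, j) 1 = single (j, i) 1" "?x - single (j, i) 1 = single (i, j) 1"
      by (simp_all add: add.commute)
    have s: "lookup ((generic_matrix n ^\<^sub>m 1) $$ (b, c)) (single v 1) = of_bool (v = (b, c))"
      if "b < n" "c < n" for b c v
      using that unfolding 0
      by (auto simp: generic_matrix_def var_poly_def lookup_single when_def single_1_eq_iff
          simp del: One_nat_def)
    have "lookup ((generic_matrix n ^\<^sub>m 2) $$ (a, a)) ?x =
      (\<Sum>l<n. if lookup ?x (l, a) = 0 then 0
       else lookup ((generic_matrix n ^\<^sub>m 1) $$ (a, l)) (?x - single (l, a) 1))"
      using lookup_generic_matrix_pow_Suc[OF that that, of 1] by (simp only: Suc_1)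
    also have "\<dots> = (\<Sum>l<n. of_bool (a = i \<and> l = j) + of_bool (a = j \<and> l = i))"
    proof (intro sum.cong refl)
      fix l assume "l \<in> {..<n}"
      consider "(l, a) = (i, j)" | "(l, a) = (j, i)" | "(l, a) \<noteq> (i, j)" "(l, a) \<noteq> (j, i)"
        by blast
      then show "(if lookup ?x (l, a) = 0 then 0
          else lookup ((generic_matrix n ^\<^sub>m 1) $$ (a, l)) (?x - single (l, a) 1)) =
          of_bool (a = i \<and> l = j) + of_bool (a = j \<and> l = i)"
        using assms s d
        by cases (auto simp: lookup_add lookup_single when_def simp del: One_nat_def)
    qed
    also have "\<dots> = of_bool (a = i \<or> a = j)"
      using assms by (cases "a = i"; cases "a = j") (simp_all add: of_bool_def)
    finally show ?thesis .
  qed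
  then have "lookup (mat_tr (generic_matrix n ^\<^sub>m 2)) ?x = (\<Sum>a<n. of_bool (a = i) + of_bool (a = j))"
    unfolding lookup_mat_tr_pow using assms(3) by (intro sum.cong) auto
  also have "\<dots> = 2"
    using assms by (simp add: of_bool_def sum.distrib)
  finally show ?thesis
    using True by simp
qed

lemma lookup_trace_operator_pair_2:
  assumes "i < j" "j < n"
  shows "lookup (trace_operator 2 n T (pair_list n i j) (mat_tr (generic_matrix n ^\<^sub>m 2))) 0 =
    2 * T [i, j] * T [j, i]"
proof -
  let ?p = "mat_tr (generic_matrix n ^\<^sub>m 2)"
  have "lookup (trace_operator 2 n T (pair_list n i j) ?p) 0 =
      (\<Sum>l'<n. T [j, l'] * (\<Sum>l<n. T [i, l] * lookup ?p (single (j, l') 1 + single (i, l) 1)))"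
    using assms by (simp add: trace_operator_pair lookup_row_operator_2 lookup_single when_def)
  also have "\<dots> = (\<Sum>l'<n. T [j, l'] * (\<Sum>l<n. T [i, l] * (2 * of_bool (l' = i \<and> l = j))))"
    using assms by (subst lookup_mat_tr_generic_matrix_sq) auto
  also have "\<dots> = (\<Sum>l'<n. if l' = i then T [j, i] * (T [i, j] * 2) else 0)"
    using assms by (intro sum.cong) (auto simp: of_bool_def if_distrib sum.delta cong: if_cong)
  also have "\<dots> = 2 * T [i, j] * T [j, i]"
    using assms by (simp add: sum.delta)
  finally show ?thesis .
qed

text \<open>The pairs of equal rows give the squares. Pairs of different rows survive only for k =
  2, where two indices can already carry an off-diagonal entry.\<close>

lemma Tr_2:
  assumes "k \<ge> 2"
    and supp: "\<And>is. length is = k \<Longrightarrow> T is \<noteq> 0 \<Longrightarrow> is = replicate k (hd is) \<or> card (set is) = k"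
  shows "Tr k n 2 T = real ((k - 1) ^ (n - 1)) * ((\<Sum>i<n. (T (replicate k i))\<^sup>2) +
    (if k = 2 then \<Sum>(i, j) | i < j \<and> j < n. 2 * T [i, j] * T [j, i] else 0))"
proof -
  let ?F = "\<lambda>(i, j). lookup (trace_operator k n T (pair_list n i j)
      (mat_tr (generic_matrix n ^\<^sub>m (2 * (k - 1))))) 0"
  let ?D = "(\<lambda>i. (i, i)) ` {..<n}" and ?P = "{(i, j). i < j \<and> j < n}"
  have P: "finite ?P"
    by (rule finite_subset[of _ "{..<n} \<times> {..<n}"]) auto
  have "Tr k n 2 T = real ((k - 1) ^ (n - 1)) * (\<Sum>x\<in>{(i, j). i \<le> j \<and> j < n}. ?F x)"
    unfolding Tr_def lists_sum_2
    by (simp add: sum.reindex[OF inj_on_pair_list[of n, unfolded case_prod_unfold]] case_prod_unfold)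
  also have "{(i, j). i \<le> j \<and> j < n} = ?D \<union> ?P"
    by auto
  also have "(\<Sum>x\<in>?D \<union> ?P. ?F x) = (\<Sum>x\<in>?D. ?F x) + (\<Sum>x\<in>?P. ?F x)"
    using P by (intro sum.union_disjoint) auto
  also have "(\<Sum>x\<in>?D. ?F x) = (\<Sum>i<n. (T (replicate k i))\<^sup>2)"
    using assms(1) by (simp add: sum.reindex inj_on_def lookup_trace_operator_pair_same del: One_nat_def)
  also have "(\<Sum>x\<in>?P. ?F x) =
      (if k = 2 then \<Sum>(i, j) | i < j \<and> j < n. 2 * T [i, j] * T [j, i] else 0)"
    using assms lookup_trace_operator_pair_eq_0[of k _ _ n T] lookup_trace_operator_pair_2[of _ _ n T]
    by (auto intro!: sum.cong sum.neutral)
  finally show ?thesis .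
qed

section \<open>The first two traces of the hypergraph tensor\<close>

lemma finite_verts [simp]: "finite (verts H)"
  by (simp add: verts_def)

lemma finite_hedges: "wf_hgraph H \<Longrightarrow> finite (hedges H)"
  by (rule finite_subset[of _ "Pow (verts H)"]) (auto simp: wf_hgraph_def)

lemma sum_vdegree:
  assumes "wf_hgraph H" "uniform_hgraph k H"
  shows "(\<Sum>v\<in>verts H. vdegree H v) = k * card (hedges H)"
proof -
  have fin: "finite (hedges H)"
    using assms(1) by (rule finite_hedges)
  have "(\<Sum>v\<in>verts H. vdegree H v) = (\<Sum>v\<in>verts H. \<Sum>e\<in>hedges H. of_bool (v \<in> e))"
    using fin by (simp add: vdegree_def sum.If_cases of_bool_def Int_def)
  also have "\<dots> = (\<Sum>e\<in>hedges H. \<Sum>v\<in>verts H. of_bool (v \<in> e))"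
    by (rule sum.swap)
  also have "\<dots> = (\<Sum>e\<in>hedges H. card e)"
  proof (rule sum.cong[OF refl])
    fix e assume "e \<in> hedges H"
    then have "verts H \<inter> {v. v \<in> e} = e"
      using assms(1) by (auto simp: wf_hgraph_def)
    then show "(\<Sum>v\<in>verts H. of_bool (v \<in> e)) = card e"
      by (simp add: of_bool_def sum.If_cases)
  qed
  also have "\<dots> = k * card (hedges H)"
    using assms(2) by (simp add: uniform_hgraph_def)
  finally show ?thesis .
qed

definition degree_square_sum :: "hgraph \<Rightarrow> nat" where
  "degree_square_sum H = (\<Sum>v\<in>verts H. (vdegree H v)\<^sup>2)"

lemma A_alpha_replicate:
  assumes "k \<ge> 2" "uniform_hgraph k H"
  shows "A_alpha \<alpha> k H (replicate k i) = \<alpha> * real (vdegree H i)"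
proof -
  have "{i} \<notin> hedges H"
    using assms by (auto simp: uniform_hgraph_def)
  then show ?thesis
    using assms(1) by (simp add: A_alpha_def degree_tensor_def adjacency_tensor_def)
qed

text \<open>Supplies the hypothesis \<open>supp\<close> of \<open>Tr_2\<close>: the degree tensor
  lives on the diagonal, and an adjacency entry requires the index set to be a hyperedge.\<close>

lemma A_alpha_support:
  assumes "uniform_hgraph k H" "A_alpha \<alpha> k H is \<noteq> 0"
  shows "is = replicate k (hd is) \<or> card (set is) = k"
  using assms by (auto simp: A_alpha_def degree_tensor_def adjacency_tensor_def uniform_hgraph_def
      split: if_splits)

lemma A_alpha_2:
  assumes "i \<noteq> j"
  shows "A_alpha \<alpha> 2 H [i, j] = (if {i, j} \<in> hedges H then 1 - \<alpha> else 0)"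
  using assms by (simp add: A_alpha_def degree_tensor_def adjacency_tensor_def numeral_2_eq_2)

lemma card_graph_edges:
  assumes "wf_hgraph H" "uniform_hgraph 2 H"
  shows "card {(i, j). i < j \<and> j < nverts H \<and> {i, j} \<in> hedges H} = card (hedges H)"
proof -
  let ?P = "{(i, j). i < j \<and> j < nverts H \<and> {i, j} \<in> hedges H}"
  have im: "(\<lambda>(i, j). {i, j}) ` ?P = hedges H"
  proof (intro equalityI subsetI)
    fix e assume e: "e \<in> hedges H"
    then have "card e = 2" "e \<subseteq> {..<nverts H}"
      using assms by (auto simp: uniform_hgraph_def wf_hgraph_def verts_def)
    then obtain a b where ab: "e = {a, b}" "a \<noteq> b" "a < nverts H" "b < nverts H"
      by (auto simp: card_2_iff)
    then have "e = (\<lambda>(i, j). {i, j}) (min a b, max a b)" "(min a b, max a b) \<in> ?P"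
      using e by (auto simp: min_def max_def insert_commute)
    then show "e \<in> (\<lambda>(i, j). {i, j}) ` ?P"
      by blast
  qed auto
  have inj: "inj_on (\<lambda>(i, j). {i, j}) ?P"
  proof (rule inj_onI, clarify)
    fix i j i' j' :: nat
    assume "i < j" "i' < j'" "{i, j} = {i', j'}"
    then show "i = i' \<and> j = j'"
      by (simp add: doubleton_eq_iff) linarith
  qed
  show ?thesis
    using card_image[OF inj] unfolding im by (rule sym)
qed

lemma Tr_1_A_alpha:
  assumes "k \<ge> 2" "wf_hgraph H" "uniform_hgraph k H"
  shows "Tr k (nverts H) 1 (A_alpha \<alpha> k H) =
    real ((k - 1) ^ (nverts H - 1)) * (\<alpha> * real (k * card (hedges H)))"
  using assms by (simp only: Tr_1 A_alpha_replicate sum_vdegree[symmetric] verts_def of_nat_sum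
      sum_distrib_left)

text \<open>For k = 2 each edge appears once as a pair i < j and contributes 2 (1 - \<alpha>)^2
  whatever the shape of the graph, so only \<open>degree_square_sum\<close> can tell two graphs with
  equally many vertices and edges apart.\<close>

lemma Tr_2_A_alpha:
  assumes "k \<ge> 2" "wf_hgraph H" "uniform_hgraph k H"
  shows "Tr k (nverts H) 2 (A_alpha \<alpha> k H) =
    real ((k - 1) ^ (nverts H - 1)) * (\<alpha>\<^sup>2 * real (degree_square_sum H) +
      (if k = 2 then 2 * (1 - \<alpha>)\<^sup>2 * real (card (hedges H)) else 0))"
proof -
  let ?n = "nverts H"
  have "(\<Sum>(i, j) | i < j \<and> j < ?n. 2 * A_alpha \<alpha> 2 H [i, j] * A_alpha \<alpha> 2 H [j, i]) =
      2 * (1 - \<alpha>)\<^sup>2 * real (card (hedges H))" if "k = 2"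
  proof -
    let ?P = "{(i, j). i < j \<and> j < ?n}"
    have P: "finite ?P"
      by (rule finite_subset[of _ "{..<?n} \<times> {..<?n}"]) auto
    have "(\<Sum>(i, j)\<in>?P. 2 * A_alpha \<alpha> 2 H [i, j] * A_alpha \<alpha> 2 H [j, i]) =
        (\<Sum>x\<in>?P. if {fst x, snd x} \<in> hedges H then 2 * (1 - \<alpha>)\<^sup>2 else 0)"
      by (intro sum.cong) (auto simp: A_alpha_2 insert_commute power2_eq_square)
    also have "\<dots> = 2 * (1 - \<alpha>)\<^sup>2 * real (card {x \<in> ?P. {fst x, snd x} \<in> hedges H})"
      using P by (simp add: sum.If_cases Int_def mult.commute)
    also have "{x \<in> ?P. {fst x, snd x} \<in> hedges H} = {(i, j). i < j \<and> j < ?n \<and> {i, j} \<in> hedges H}"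
      by auto
    finally show ?thesis
      using card_graph_edges assms(2,3) that by simp
  qed
  moreover have "(\<Sum>i<?n. (A_alpha \<alpha> k H (replicate k i))\<^sup>2) = \<alpha>\<^sup>2 * real (degree_square_sum H)"
    using assms by (simp add: A_alpha_replicate degree_square_sum_def verts_def power_mult_distrib
        sum_distrib_left)
  ultimately show ?thesis
    using Tr_2[where n = ?n and T = "A_alpha \<alpha> k H", OF assms(1) A_alpha_support[OF assms(3)]] by simp
qed

lemma S_less_if_degree_square_sum_less:
  assumes "k \<ge> 2" "\<alpha> > 0" "wf_hgraph H" "uniform_hgraph k H" "wf_hgraph G" "uniform_hgraph k G"
    and "nverts H = nverts G" "nverts G \<ge> 3" "card (hedges H) = card (hedges G)"
    and "degree_square_sum H < degree_square_sum G"
  shows "S_less \<alpha> k H G"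
proof -
  let ?n = "nverts G"
  have pos: "(k - 1) ^ (?n - 1) \<ge> 1"
    using assms(1) by simp
  \<comment> \<open>The order compares traces only up to index n (k-1)^(n-1) - 1; three vertices
    make the index 2 admissible.\<close>
  then have "3 * 1 \<le> ?n * (k - 1) ^ (?n - 1)"
    using assms(8) by (intro mult_mono) auto
  then have "2 \<in> {1..?n * (k - 1) ^ (?n - 1) - 1}"
    by auto
  moreover have "Tr k ?n t (A_alpha \<alpha> k H) = Tr k ?n t (A_alpha \<alpha> k G)" if "t < 2" for t
  proof -
    have "t = 0 \<or> t = 1"
      using that by auto
    then show ?thesis
    proof
      assume "t = 0"
      then show ?thesis
        by (simp add: Tr_def)
    next
      assume "t = 1"
      then show ?thesis
        using Tr_1_A_alpha[of k H \<alpha>] Tr_1_A_alpha[of k G \<alpha>] assms by metis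
    qed
  qed
  moreover have "Tr k ?n 2 (A_alpha \<alpha> k H) < Tr k ?n 2 (A_alpha \<alpha> k G)"
  proof -
    have "real ((k - 1) ^ (?n - 1)) > 0"
      using pos by linarith
    moreover have "\<alpha>\<^sup>2 * real (degree_square_sum H) < \<alpha>\<^sup>2 * real (degree_square_sum G)"
      using assms(2,10) by simp
    ultimately show ?thesis
      using Tr_2_A_alpha[of k H \<alpha>] Tr_2_A_alpha[of k G \<alpha>] assms(1,3-7,9)
      by (simp add: mult_less_cancel_left_pos)
  qed
  ultimately show ?thesis
    unfolding S_less_def assms(7) by blast
qed

section \<open>Cycles and the number of vertices\<close>

text \<open>Adjacency, cycles and connectedness are restated for a bare set of hyperedges, with its
  union as vertex set, because the vertex count runs through subsets of \<open>hedges H\<close> that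
  need not cover \<open>verts H\<close>.\<close>

definition edge_adj :: "nat set set \<Rightarrow> (nat \<times> nat) set" where
  "edge_adj F = {(u, v). \<exists>e\<in>F. u \<in> e \<and> v \<in> e}"

definition edge_cycle :: "nat set set \<Rightarrow> nat list \<Rightarrow> nat set list \<Rightarrow> bool" where
  "edge_cycle F vs es \<longleftrightarrow>
     length vs = length es \<and> length vs \<ge> 2 \<and> distinct vs \<and> distinct es \<and> set es \<subseteq> F \<and>
     (\<forall>i<length vs. vs ! i \<in> es ! i \<and> vs ! (Suc i mod length vs) \<in> es ! i)"

definition edge_connected :: "nat set set \<Rightarrow> bool" where
  "edge_connected F \<longleftrightarrow> (\<forall>u\<in>\<Union>F. \<forall>v\<in>\<Union>F. (u, v) \<in> (edge_adj F)\<^sup>*)"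

definition edge_unicyclic :: "nat set set \<Rightarrow> bool" where
  "edge_unicyclic F \<longleftrightarrow> (\<exists>!C. \<exists>vs es. edge_cycle F vs es \<and> C = cycle_incidences vs es)"

lemma adj_rel_eq_edge_adj: "adj_rel H = edge_adj (hedges H)"
  by (simp add: adj_rel_def edge_adj_def)

lemma unicyclic_hgraph_iff: "unicyclic_hgraph H \<longleftrightarrow> connected_hgraph H \<and> edge_unicyclic (hedges H)"
  by (simp add: unicyclic_hgraph_def edge_unicyclic_def is_cycle_def edge_cycle_def)

lemma edge_adj_rtrancl_sym: "(u, v) \<in> (edge_adj F)\<^sup>* \<Longrightarrow> (v, u) \<in> (edge_adj F)\<^sup>*"
proof -
  have "sym ((edge_adj F)\<^sup>*)"
    by (intro sym_rtrancl) (auto simp: sym_def edge_adj_def)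
  then show "(u, v) \<in> (edge_adj F)\<^sup>* \<Longrightarrow> (v, u) \<in> (edge_adj F)\<^sup>*"
    by (rule symD)
qed

lemma edge_adj_rtrancl_mono: "F \<subseteq> G \<Longrightarrow> (u, v) \<in> (edge_adj F)\<^sup>* \<Longrightarrow> (u, v) \<in> (edge_adj G)\<^sup>*"
  by (rule subsetD[OF rtrancl_mono]) (auto simp: edge_adj_def)

lemma edge_adjI: "e \<in> F \<Longrightarrow> u \<in> e \<Longrightarrow> v \<in> e \<Longrightarrow> (u, v) \<in> edge_adj F"
  by (auto simp: edge_adj_def)

lemma edge_cycle_mono: "edge_cycle F vs es \<Longrightarrow> F \<subseteq> G \<Longrightarrow> edge_cycle G vs es"
  by (auto simp: edge_cycle_def)

text \<open>The two edges are those following and preceding v on the cycle; they differ because the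
  length is at least 2.\<close>

lemma edge_cycle_vertex:
  assumes "edge_cycle F vs es" "v \<in> set vs"
  shows "\<exists>e f. e \<noteq> f \<and> (v, e) \<in> cycle_incidences vs es \<and> (v, f) \<in> cycle_incidences vs es"
proof -
  let ?l = "length vs"
  have c: "length es = ?l" "?l \<ge> 2" "distinct es"
      "\<And>i. i < ?l \<Longrightarrow> vs ! i \<in> es ! i \<and> vs ! (Suc i mod ?l) \<in> es ! i"
    using assms(1) by (auto simp: edge_cycle_def)
  obtain i where i: "i < ?l" "v = vs ! i"
    using assms(2) by (auto simp: in_set_conv_nth)
  define j where "j = (if i = 0 then ?l - 1 else i - 1)"
  have j: "j < ?l" "Suc j mod ?l = i" "j \<noteq> i"
    using i(1) c(2) by (auto simp: j_def)
  have "es ! i \<noteq> es ! j"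
    using c(1,3) i(1) j(1,3) by (simp add: nth_eq_iff_index_eq)
  moreover have "(v, es ! i) \<in> cycle_incidences vs es" "(v, es ! j) \<in> cycle_incidences vs es"
    unfolding cycle_incidences_def using i j by auto
  ultimately show ?thesis
    by blast
qed

lemma cycle_incidencesD:
  assumes "edge_cycle F vs es" "(x, e) \<in> cycle_incidences vs es"
  shows "x \<in> set vs \<and> e \<in> set es \<and> x \<in> e \<and> e \<in> F"
proof -
  have "Suc i mod length vs < length vs" if "i < length vs" for i
    using that by (intro mod_less_divisor) auto
  then show ?thesis
    using assms unfolding edge_cycle_def cycle_incidences_def by (auto intro: nth_mem)
qed

lemma edge_cycle_edge:
  assumes "edge_cycle F vs es" "e \<in> set es"
  shows "\<exists>u\<in>set vs. \<exists>v\<in>set vs. u \<noteq> v \<and> u \<in> e \<and> v \<in> e"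
proof -
  let ?l = "length vs"
  have c: "length es = ?l" "?l \<ge> 2" "distinct vs"
      "\<And>i. i < ?l \<Longrightarrow> vs ! i \<in> es ! i \<and> vs ! (Suc i mod ?l) \<in> es ! i"
    using assms(1) by (auto simp: edge_cycle_def)
  obtain i where i: "i < ?l" "e = es ! i"
    using assms(2) c(1) by (auto simp: in_set_conv_nth)
  have "Suc i mod ?l \<noteq> i"
    using i(1) c(2) by (cases "Suc i = ?l") auto
  moreover have "Suc i mod ?l < ?l"
    using c(2) by (intro mod_less_divisor) auto
  ultimately have "vs ! (Suc i mod ?l) \<noteq> vs ! i"
    using c(3) i(1) by (simp add: nth_eq_iff_index_eq)
  then show ?thesis
    using c(4)[OF i(1)] i \<open>Suc i mod ?l < ?l\<close> by (metis nth_mem)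
qed

text \<open>An edge of a cycle contains two distinct cycle vertices. If the edge is e, each of them
  also lies on an edge other than e, hence in \<open>\<Union>F\<close>, so e would meet
  \<open>\<Union>F\<close> twice.\<close>

lemma edge_cycle_delete_pendant:
  assumes cyc: "edge_cycle (insert e F) vs es" and "finite e" "card (e \<inter> \<Union>F) \<le> 1"
  shows "edge_cycle F vs es"
proof -
  have sub: "set es \<subseteq> insert e F"
    using cyc by (simp add: edge_cycle_def)
  have "e \<notin> set es"
  proof
    assume "e \<in> set es"
    from edge_cycle_edge[OF cyc this] obtain u v where
      uv: "u \<in> set vs" "v \<in> set vs" "u \<noteq> v" "u \<in> e" "v \<in> e"
      by blast
    have "x \<in> \<Union>F" if x: "x \<in> set vs" for x
    proof -
      obtain f g where "f \<noteq> g" "(x, f) \<in> cycle_incidences vs es" "(x, g) \<in> cycle_incidences vs es"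
        using edge_cycle_vertex[OF cyc x] by blast
      then show ?thesis
        using cycle_incidencesD[OF cyc, of x f] cycle_incidencesD[OF cyc, of x g] by blast
    qed
    with uv have "{u, v} \<subseteq> e \<inter> \<Union>F"
      by blast
    then have "card {u, v} \<le> card (e \<inter> \<Union>F)"
      using \<open>finite e\<close> by (intro card_mono) auto
    then show False
      using uv(3) assms(3) by simp
  qed
  then show ?thesis
    using cyc sub by (auto simp: edge_cycle_def)
qed

lemma edge_cycle_insert_pendant:
  assumes "finite e" "card (e \<inter> \<Union>F) \<le> 1"
  shows "edge_cycle (insert e F) vs es \<longleftrightarrow> edge_cycle F vs es"
  using edge_cycle_delete_pendant[OF _ assms] edge_cycle_mono[of F vs es "insert e F"] by blast



text \<open>On a shortest path the \<open>j\<close>-th vertex has distance \<open>j\<close> from the start, so neither vertices nor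
  edges repeat.\<close>

lemma edge_cycle_closing_path:
  assumes "e \<notin> F" "u \<noteq> v" "u \<in> e" "v \<in> e" "(u, v) \<in> (edge_adj F)\<^sup>*"
  obtains vs es where "edge_cycle (insert e F) vs es" "{x. (x, e) \<in> cycle_incidences vs es} = {u, v}"
proof -
  let ?R = "edge_adj F"
  define l where "l = (LEAST n. (u, v) \<in> ?R ^^ n)"
  have "\<exists>n. (u, v) \<in> ?R ^^ n"
    using assms(5) by (simp add: rtrancl_power)
  then have "(u, v) \<in> ?R ^^ l"
    unfolding l_def by (rule LeastI_ex)
  then obtain p where p: "p 0 = u" "p l = v" "\<And>i. i < l \<Longrightarrow> (p i, p (Suc i)) \<in> ?R"
    unfolding relpow_fun_conv by auto
  have near: "(u, p j) \<in> ?R ^^ j" if "j \<le> l" for j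
    unfolding relpow_fun_conv using p that by (intro exI[of _ p]) auto
  \<comment> \<open>Otherwise a shorter way to \<open>p j\<close>, continued along p, would undercut
    the minimal length l.\<close>
  have far: "j \<le> a" if "j \<le> l" "(u, p j) \<in> ?R ^^ a" for j a
  proof -
    have "(p j, v) \<in> ?R ^^ (l - j)"
      unfolding relpow_fun_conv using p that(1) by (intro exI[of _ "\<lambda>t. p (j + t)"]) auto
    then have "(u, v) \<in> ?R ^^ (a + (l - j))"
      using that(2) by (auto simp: relpow_add)
    then have "l \<le> a + (l - j)"
      unfolding l_def by (rule Least_le)
    then show ?thesis
      using that(1) by simp
  qed
  have "l > 0"
    using p(1,2) assms(2) by (cases l) auto
  have "\<forall>i. \<exists>f. i < l \<longrightarrow> f \<in> F \<and> p i \<in> f \<and> p (Suc i) \<in> f"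
    using p(3) by (auto simp: edge_adj_def)
  then obtain f where f: "\<And>i. i < l \<Longrightarrow> f i \<in> F \<and> p i \<in> f i \<and> p (Suc i) \<in> f i"
    by metis
  have "i = j" if "i \<le> l" "j \<le> l" "p i = p j" for i j
    using near[OF that(1)] near[OF that(2)] far[OF that(1)] far[OF that(2)] that(3)
    by (metis le_antisym)
  then have inj_p: "inj_on p {0..<Suc l}"
    by (auto simp: inj_on_def)
  \<comment> \<open>If the edge \<open>f i\<close> recurred at a position j > i, one step inside it
    from \<open>p i\<close> to \<open>p (Suc j)\<close> would reach that vertex too early.\<close>
  have le: "j \<le> i" if "i < l" "j < l" "f i = f j" for i j
  proof -
    have "(p i, p (Suc j)) \<in> ?R"
      using f[OF that(1)] f[OF that(2)] that(3) by (auto intro: edge_adjI)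
    then have "(u, p (Suc j)) \<in> ?R ^^ Suc i"
      using near[of i] that(1) by auto
    then show ?thesis
      using far[of "Suc j" "Suc i"] that(2) by simp
  qed
  have inj_f: "inj_on f {0..<l}"
    using le by (auto simp: inj_on_def intro: le_antisym)
  let ?vs = "map p [0..<Suc l]" and ?es = "map f [0..<l] @ [e]"
  have es: "?es ! i = (if i = l then e else f i)" if "i < Suc l" for i
    using that by (auto simp: nth_append)
  have vs: "?vs ! i = p i" if "i < Suc l" for i
    using that by (simp only: nth_map length_upt nth_upt) simp
  have next_vs: "?vs ! (Suc i mod Suc l) = (if i = l then u else p (Suc i))" if "i < Suc l" for i
    using that vs[of "Suc i"] vs[of 0] p(1) by (cases "i = l") (auto simp del: upt_Suc)
  have "edge_cycle (insert e F) ?vs ?es"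
    unfolding edge_cycle_def
  proof (intro conjI)
    show "\<forall>i<length ?vs. ?vs ! i \<in> ?es ! i \<and> ?vs ! (Suc i mod length ?vs) \<in> ?es ! i"
    proof (intro allI impI)
      fix i assume "i < length ?vs"
      then have i: "i < Suc l"
        by simp
      show "?vs ! i \<in> ?es ! i \<and> ?vs ! (Suc i mod length ?vs) \<in> ?es ! i"
        using i f[of i] p(2) assms(3,4) next_vs[OF i] unfolding es[OF i] vs[OF i]
        by (auto simp del: upt_Suc)
    qed
    show "distinct ?vs"
      using inj_p by (simp add: distinct_map del: upt_Suc)
    show "distinct ?es"
      using inj_f f assms(1) by (auto simp: distinct_map)
    show "set ?es \<subseteq> insert e F"
      using f by auto
    show "2 \<le> length ?vs" "length ?vs = length ?es"
      using \<open>l > 0\<close> by simp_all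
  qed
  \<comment> \<open>The edge e stands at position l, whose cyclic successor is 0, so its incidences
    are with \<open>p l = v\<close> and \<open>p 0 = u\<close>. Where the cycle is unique, this pins
    down the pair.\<close>
  moreover have "{x. (x, e) \<in> cycle_incidences ?vs ?es} = {u, v}"
  proof -
    have es_e: "?es ! i = e \<longleftrightarrow> i = l" if "i < Suc l" for i
      using es[OF that] f[of i] that assms(1) by auto
    have "(x, e) \<in> cycle_incidences ?vs ?es \<longleftrightarrow>
        (\<exists>i<Suc l. ?es ! i = e \<and> (x = ?vs ! i \<or> x = ?vs ! (Suc i mod Suc l)))" for x
      unfolding cycle_incidences_def by (auto simp del: upt_Suc)
    also have "\<dots> x \<longleftrightarrow> x = v \<or> x = u" for x
      using es_e vs[of l] next_vs[of l] p(2) by (metis lessI)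
    finally show ?thesis
      by auto
  qed
  ultimately show thesis
    by (rule that)
qed

section \<open>Connected growth and the number of vertices\<close>

lemma edge_connected_insert:
  assumes "edge_connected F" "x \<in> e" "x \<in> \<Union>F"
  shows "edge_connected (insert e F)"
proof -
  have to_x: "(u, x) \<in> (edge_adj (insert e F))\<^sup>*" if "u \<in> \<Union>(insert e F)" for u
  proof (cases "u \<in> e")
    case True
    then show ?thesis
      using assms(2) by (intro r_into_rtrancl edge_adjI[of e]) auto
  next
    case False
    then have "(u, x) \<in> (edge_adj F)\<^sup>*"
      using assms(1,3) that by (auto simp: edge_connected_def)
    then show ?thesis
      by (rule edge_adj_rtrancl_mono[rotated]) auto
  qed
  show ?thesis
    unfolding edge_connected_def using to_x edge_adj_rtrancl_sym[OF to_x]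
    by (meson rtrancl_trans)
qed

text \<open>If no edge outside F met \<open>\<Union>F\<close>, this set would be closed under
  adjacency in E and connectedness would fail.\<close>

lemma edge_connected_extend:
  assumes "edge_connected E" "F \<subset> E" "F \<noteq> {}" "\<And>e. e \<in> E \<Longrightarrow> e \<noteq> {}"
  obtains e x where "e \<in> E - F" "x \<in> e" "x \<in> \<Union>F"
proof (rule ccontr)
  assume "\<not> thesis"
  then have disj: "\<And>e x. e \<in> E - F \<Longrightarrow> x \<in> e \<Longrightarrow> x \<notin> \<Union>F"
    using that by blast
  obtain g where g: "g \<in> E - F"
    using assms(2) by blast
  then obtain y where y: "y \<in> g"
    using assms(4) by blast
  obtain f x where x: "f \<in> F" "x \<in> f"
    using assms(2,3,4) by blast
  have "(x, y) \<in> (edge_adj E)\<^sup>*"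
    using assms(1,2) x g y by (auto simp: edge_connected_def)
  then have "y \<in> \<Union>F"
  proof induction
    case base
    then show ?case
      using x by blast
  next
    case (step y z)
    then show ?case
      using disj by (fastforce simp: edge_adj_def)
  qed
  then show False
    using disj g y by blast
qed

text \<open>Grow a connected set of edges one edge at a time: every new edge meets the old vertices
  in a single vertex, except that the edge closing the unique cycle meets them in two.\<close>

lemma edge_unicyclic_partial:
  assumes fin: "finite E" and card_k: "\<And>e. e \<in> E \<Longrightarrow> card e = k" and k: "k \<ge> 2"
    and conn: "edge_connected E" and uni: "edge_unicyclic E"
  shows "Suc j \<le> card E \<Longrightarrow> \<exists>F\<subseteq>E. card F = Suc j \<and> edge_connected F \<and>
      card (\<Union>F) + of_bool (\<exists>vs es. edge_cycle F vs es) = Suc j * (k - 1) + 1"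
proof (induction j)
  case 0
  then obtain e where e: "e \<in> E"
    using card_gt_0_iff[of E] by auto
  have "\<not> edge_cycle {e} vs es" for vs es
  proof
    assume c: "edge_cycle {e} vs es"
    then have "card (set es) = length es" "length es \<ge> 2" "set es \<subseteq> {e}"
      by (auto simp: edge_cycle_def distinct_card)
    then show False
      using card_mono[of "{e}" "set es"] by simp
  qed
  moreover have "edge_connected {e}"
    by (auto simp: edge_connected_def edge_adj_def)
  ultimately show ?case
    using e card_k[OF e] k by (intro exI[of _ "{e}"]) auto
next
  case (Suc j)
  \<comment> \<open>Uniqueness is used in this form: every cycle of E, and so of any subset of E,
    has the incidence set C.\<close>
  obtain C where C: "\<And>vs es. edge_cycle E vs es \<Longrightarrow> cycle_incidences vs es = C"
    using uni unfolding edge_unicyclic_def by metis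
  from Suc obtain F where F: "F \<subseteq> E" "card F = Suc j" "edge_connected F"
      "card (\<Union>F) + of_bool (\<exists>vs es. edge_cycle F vs es) = Suc j * (k - 1) + 1"
    by (metis Suc_leD)
  have finF: "finite F"
    using F(1) fin by (rule finite_subset)
  have fin_e: "finite e" if "e \<in> E" for e
    using card_k[OF that] k by (metis card.infinite not_numeral_le_zero)
  have finU: "finite (\<Union>F)"
    using finF F(1) fin_e by blast
  have "F \<noteq> {}" "F \<subset> E"
    using F(1,2) Suc.prems by auto
  moreover have "e \<noteq> {}" if "e \<in> E" for e
    using card_k[OF that] k by auto
  ultimately obtain e x where e: "e \<in> E - F" "x \<in> e" "x \<in> \<Union>F"
    using edge_connected_extend[OF conn] by metis
  let ?G = "insert e F"
  have G: "?G \<subseteq> E" "card ?G = Suc (Suc j)" "edge_connected ?G"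
    using F(1,2) e finF edge_connected_insert[OF F(3) e(2,3)] by auto
  \<comment> \<open>Two old vertices on the new edge e close a cycle through e, and C remembers
    which two they are.\<close>
  have closing: "\<exists>vs es. edge_cycle ?G vs es" "{x. (x, e) \<in> C} = {u, v}"
    if neq: "u \<noteq> v" and mem: "u \<in> e \<inter> \<Union>F" "v \<in> e \<inter> \<Union>F" for u v
  proof -
    have "e \<notin> F" "u \<in> e" "v \<in> e" "(u, v) \<in> (edge_adj F)\<^sup>*"
      using e(1) F(3) mem by (auto simp: edge_connected_def)
    then obtain vs es where c: "edge_cycle ?G vs es" "{x. (x, e) \<in> cycle_incidences vs es} = {u, v}"
      using edge_cycle_closing_path[OF _ neq] by metis
    then show "\<exists>vs es. edge_cycle ?G vs es"
      by blast
    show "{x. (x, e) \<in> C} = {u, v}"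
      using c C[OF edge_cycle_mono[OF c(1) G(1)]] by simp
  qed
  have fin_e': "finite e" "finite (e \<inter> \<Union>F)"
    using fin_e e(1) by auto
  have card_Union: "card (\<Union>?G) + card (e \<inter> \<Union>F) = k + card (\<Union>F)"
    using card_Un_Int[OF fin_e'(1) finU] card_k[of e] e(1) by simp
  have "card (e \<inter> \<Union>F) > 0"
    unfolding card_gt_0_iff using e(2,3) fin_e'(2) by blast
  moreover have "card (e \<inter> \<Union>F) \<le> 2"
  proof (rule ccontr)
    assume "\<not> ?thesis"
    then have "3 \<le> card (e \<inter> \<Union>F)"
      by linarith
    then obtain T where T: "T \<subseteq> e \<inter> \<Union>F" "card T = 3"
      by (rule obtain_subset_with_card_n)
    then obtain u v w where "T = {u, v, w}" "u \<noteq> v" "u \<noteq> w" "v \<noteq> w"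
      by (auto simp: card_3_iff)
    then have uvw: "u \<noteq> v" "u \<noteq> w" "v \<noteq> w" "u \<in> e \<inter> \<Union>F" "v \<in> e \<inter> \<Union>F" "w \<in> e \<inter> \<Union>F"
      using T(1) by blast+
    \<comment> \<open>Three attachment vertices would close two cycles with different incidences at
      e.\<close>
    have "{u, v} = {u, w}"
      using closing(2)[OF uvw(1,4,5)] closing(2)[OF uvw(2,4,6)] by simp
    then show False
      using uvw(1-3) by (auto simp: doubleton_eq_iff)
  qed
  ultimately consider "card (e \<inter> \<Union>F) = 1" | "card (e \<inter> \<Union>F) = 2"
    by linarith
  \<comment> \<open>One attachment vertex adds k - 1 vertices and no cycle. Two add k - 2, and the
    missing one is made up by \<open>of_bool\<close> switching from 0 to 1.\<close>
  then have "card (\<Union>?G) + of_bool (\<exists>vs es. edge_cycle ?G vs es) = Suc (Suc j) * (k - 1) + 1"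
  proof cases
    case 1
    then have "edge_cycle ?G vs es \<longleftrightarrow> edge_cycle F vs es" for vs es
      using fin_e'(1) by (intro edge_cycle_insert_pendant) auto
    then show ?thesis
      using 1 F(4) card_Union k by simp
  next
    case 2
    then obtain u v where "e \<inter> \<Union>F = {u, v}" "u \<noteq> v"
      unfolding card_2_iff by blast
    then have uv: "u \<noteq> v" "u \<in> e \<inter> \<Union>F" "v \<in> e \<inter> \<Union>F"
      by blast+
    \<comment> \<open>A cycle inside F would have the incidence set C too, but C has incidences at
      e, which is not in F.\<close>
    have "\<not> edge_cycle F vs es" for vs es
    proof
      assume c: "edge_cycle F vs es"
      have "(u, e) \<in> cycle_incidences vs es"
        using closing(2)[OF uv] C[OF edge_cycle_mono[OF c F(1)]] by blast
      then show False
        using cycle_incidencesD[OF c] e(1) by blast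
    qed
    then show ?thesis
      using 2 F(4) card_Union k closing(1)[OF uv] by simp
  qed
  with G show ?case
    by blast
qed

lemma edge_unicyclic_card_Union:
  assumes "finite E" "\<And>e. e \<in> E \<Longrightarrow> card e = k" "k \<ge> 2" "edge_connected E" "edge_unicyclic E"
  shows "card (\<Union>E) = card E * (k - 1)"
proof -
  obtain vs es where c: "edge_cycle E vs es"
    using assms(5) unfolding edge_unicyclic_def by blast
  then have "E \<noteq> {}"
    by (auto simp: edge_cycle_def)
  then have "Suc (card E - 1) = card E"
    using assms(1) by (simp add: card_gt_0_iff)
  with edge_unicyclic_partial[OF assms, of "card E - 1"] obtain F where
    F: "F \<subseteq> E" "card F = card E" "card (\<Union>F) + of_bool (\<exists>vs es. edge_cycle F vs es) = card E * (k - 1) + 1"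
    by auto
  have "F = E"
    using card_subset_eq[OF assms(1) F(1,2)] .
  moreover have "\<exists>vs es. edge_cycle E vs es"
    using c by blast
  ultimately show ?thesis
    using F(3) by simp
qed

text \<open>As soon as there is one nonempty edge, a vertex reachable from it lies on an edge
  itself, so connectedness excludes isolated vertices.\<close>

lemma connected_hgraph_iff:
  assumes "wf_hgraph H" "hedges H \<noteq> {}" "{} \<notin> hedges H"
  shows "connected_hgraph H \<longleftrightarrow> \<Union>(hedges H) = verts H \<and> edge_connected (hedges H)"
proof -
  obtain e where e: "e \<in> hedges H"
    using assms(2) by blast
  with assms(3) have "e \<noteq> {}"
    by metis
  with e obtain x where x: "e \<in> hedges H" "x \<in> e"
    by blast
  have "verts H \<noteq> {}"
    using assms(1) x by (auto simp: wf_hgraph_def)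
  show ?thesis
  proof
    assume c: "connected_hgraph H"
    have "v \<in> \<Union>(hedges H)" if "v \<in> verts H" for v
    proof -
      have "x \<in> verts H"
        using assms(1) x by (auto simp: wf_hgraph_def)
      then have "(x, v) \<in> (edge_adj (hedges H))\<^sup>*"
        using c that by (simp add: connected_hgraph_def adj_rel_eq_edge_adj)
      then show ?thesis
        by (cases rule: rtranclE) (use x in \<open>auto simp: edge_adj_def\<close>)
    qed
    then have "\<Union>(hedges H) = verts H"
      using assms(1) by (auto simp: wf_hgraph_def)
    then show "\<Union>(hedges H) = verts H \<and> edge_connected (hedges H)"
      using c by (simp add: connected_hgraph_def edge_connected_def adj_rel_eq_edge_adj)
  next
    assume "\<Union>(hedges H) = verts H \<and> edge_connected (hedges H)"
    then show "connected_hgraph H"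
      unfolding connected_hgraph_def edge_connected_def adj_rel_eq_edge_adj
      using \<open>verts H \<noteq> {}\<close> by (elim conjE) (simp only: not_False_eq_True simp_thms)
  qed
qed

lemma linear_unicyclic_class_iff:
  assumes "k \<ge> 2" "m \<ge> 1"
  shows "H \<in> linear_unicyclic_class k m \<longleftrightarrow> wf_hgraph H \<and> uniform_hgraph k H \<and> linear_hgraph H \<and>
    \<Union>(hedges H) = verts H \<and> edge_connected (hedges H) \<and> edge_unicyclic (hedges H) \<and> card (hedges H) = m"
proof -
  have "hedges H \<noteq> {}" if "card (hedges H) = m"
    using that assms(2) by auto
  moreover have "{} \<notin> hedges H" if "uniform_hgraph k H"
    using that assms(1) by (auto simp: uniform_hgraph_def)
  ultimately show ?thesis
    using connected_hgraph_iff[of H]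
    by (auto simp: linear_unicyclic_class_def unicyclic_hgraph_iff)
qed

lemma linear_unicyclic_nverts:
  assumes "k \<ge> 2" "m \<ge> 1" "H \<in> linear_unicyclic_class k m"
  shows "nverts H = m * (k - 1)"
proof -
  have H: "wf_hgraph H" "uniform_hgraph k H" "\<Union>(hedges H) = verts H" "edge_connected (hedges H)"
      "edge_unicyclic (hedges H)" "card (hedges H) = m"
    using assms(3) by (simp_all add: linear_unicyclic_class_iff[OF assms(1,2)])
  have "card (verts H) = m * (k - 1)"
    using edge_unicyclic_card_Union[OF finite_hedges[OF H(1)] _ assms(1) H(4,5)] H(2,3,6)
    by (simp add: uniform_hgraph_def)
  then show ?thesis
    by (simp add: verts_def)
qed

section \<open>Adding pendant hyperedges to the hypertriangle\<close>

lemma linear_hgraphD: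
  assumes "linear_hgraph H" "e \<in> hedges H" "f \<in> hedges H" "finite e"
    and "x \<in> e" "x \<in> f" "y \<in> e" "y \<in> f" "x \<noteq> y"
  shows "e = f"
proof (rule ccontr)
  assume "e \<noteq> f"
  then have "card (e \<inter> f) \<le> 1"
    using assms(1-3) by (simp add: linear_hgraph_def)
  moreover have "card {x, y} \<le> card (e \<inter> f)"
    using assms(4-8) by (intro card_mono) auto
  ultimately show False
    using assms(9) by simp
qed

lemma nverts_add_pendant [simp]: "nverts (add_pendant k v H) = nverts H + (k - 1)"
  by (simp add: add_pendant_def)

lemma hedges_add_pendant:
  "hedges (add_pendant k v H) = insert (insert v {nverts H..<nverts H + (k - 1)}) (hedges H)"
  by (simp add: add_pendant_def)

lemma pendant_edge_not_in_hedges: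
  assumes "wf_hgraph H" "k \<ge> 2"
  shows "insert v {nverts H..<nverts H + (k - 1)} \<notin> hedges H"
proof
  assume "insert v {nverts H..<nverts H + (k - 1)} \<in> hedges H"
  moreover have "nverts H \<in> insert v {nverts H..<nverts H + (k - 1)}"
    using assms(2) by auto
  ultimately show False
    using assms(1) by (fastforce simp: wf_hgraph_def verts_def)
qed

text \<open>The new edge meets the old vertices only in v, so it lies on no cycle and the set of
  cycles is unchanged.\<close>

lemma add_pendant_linear_unicyclic:
  assumes "k \<ge> 2" "m \<ge> 1" "H \<in> linear_unicyclic_class k m" "v \<in> verts H"
  shows "add_pendant k v H \<in> linear_unicyclic_class k (Suc m)"
proof -
  let ?n = "nverts H" and ?E = "hedges H"
  let ?N = "insert v {?n..<?n + (k - 1)}"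
  have H: "wf_hgraph H" "uniform_hgraph k H" "linear_hgraph H" "\<Union>?E = verts H" "edge_connected ?E"
      "edge_unicyclic ?E" "card ?E = m"
    using assms(3) by (simp_all add: linear_unicyclic_class_iff[OF assms(1,2)])
  have v: "v < ?n"
    using assms(4) by (simp add: verts_def)
  have N_Int: "?N \<inter> \<Union>?E = {v}"
    using v unfolding H(4) by (auto simp: verts_def)
  have "v \<in> \<Union>?E"
    using assms(4) H(4) by simp
  then have "edge_connected (insert ?N ?E)"
    by (intro edge_connected_insert[OF H(5), of v]) auto
  moreover have "edge_cycle (insert ?N ?E) vs es \<longleftrightarrow> edge_cycle ?E vs es" for vs es
    using N_Int by (intro edge_cycle_insert_pendant) auto
  then have "edge_unicyclic (insert ?N ?E)"
    using H(6) by (simp add: edge_unicyclic_def)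
  moreover have "card (?N \<inter> e) \<le> 1" if "e \<in> ?E" for e
  proof -
    have "?N \<inter> e \<subseteq> {v}"
      using N_Int that by blast
    then show ?thesis
      using card_mono[of "{v}" "?N \<inter> e"] by simp
  qed
  then have "linear_hgraph (add_pendant k v H)"
    using H(3) by (auto simp: linear_hgraph_def hedges_add_pendant Int_commute)
  moreover have "wf_hgraph (add_pendant k v H)"
    using H(1) v by (fastforce simp: wf_hgraph_def verts_def hedges_add_pendant)
  moreover have "card ?N = k"
    using v assms(1) by simp
  then have "uniform_hgraph k (add_pendant k v H)"
    using H(2) by (simp add: uniform_hgraph_def hedges_add_pendant)
  moreover have "\<Union>(insert ?N ?E) = verts (add_pendant k v H)"
    using v H(4) by (auto simp: verts_def)
  moreover have "card (insert ?N ?E) = Suc m"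
    using H(7) pendant_edge_not_in_hedges[OF H(1) assms(1)] finite_hedges[OF H(1)] by simp
  ultimately show ?thesis
    using linear_unicyclic_class_iff[of k "Suc m" "add_pendant k v H"] assms(1)
    by (simp add: hedges_add_pendant)
qed

section \<open>The hypertriangle\<close>

definition triangle_edge :: "nat \<Rightarrow> nat \<Rightarrow> nat set" where
  "triangle_edge k i = {i, Suc i mod 3} \<union> {3 + i * (k - 2)..<3 + Suc i * (k - 2)}"

lemma hedges_hypercycle_3:
  "hedges (hypercycle k 3) = {triangle_edge k 0, triangle_edge k 1, triangle_edge k 2}"
proof -
  have "{..<3::nat} = {0, 1, 2}"
    by auto
  then show ?thesis
    by (simp add: hypercycle_def triangle_edge_def)
qed

lemma triangle_edge_iff:
  "x \<in> triangle_edge k 0 \<longleftrightarrow> x = 0 \<or> x = 1 \<or> 3 \<le> x \<and> x < 3 + (k - 2)"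
  "x \<in> triangle_edge k (Suc 0) \<longleftrightarrow> x = 1 \<or> x = 2 \<or> 3 + (k - 2) \<le> x \<and> x < 3 + 2 * (k - 2)"
  "x \<in> triangle_edge k 2 \<longleftrightarrow> x = 2 \<or> x = 0 \<or> 3 + 2 * (k - 2) \<le> x \<and> x < 3 + 3 * (k - 2)"
  by (auto simp: triangle_edge_def)

lemma triangle_edges_distinct:
  "triangle_edge k 0 \<noteq> triangle_edge k 1" "triangle_edge k 1 \<noteq> triangle_edge k 2"
  "triangle_edge k 0 \<noteq> triangle_edge k 2"
proof -
  have "0 \<in> triangle_edge k 0" "0 \<notin> triangle_edge k 1" "1 \<in> triangle_edge k 1" "1 \<notin> triangle_edge k 2"
      "1 \<in> triangle_edge k 0"
    by (simp_all add: triangle_edge_iff)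
  then show "triangle_edge k 0 \<noteq> triangle_edge k 1" "triangle_edge k 1 \<noteq> triangle_edge k 2"
    "triangle_edge k 0 \<noteq> triangle_edge k 2"
    by metis+
qed

lemma triangle_edges_Int:
  "triangle_edge k 0 \<inter> triangle_edge k 1 = {1}" "triangle_edge k 1 \<inter> triangle_edge k 2 = {2}"
  "triangle_edge k 0 \<inter> triangle_edge k 2 = {0}"
  by (auto simp: triangle_edge_iff set_eq_iff)

lemma triangle_edge_card:
  assumes "k \<ge> 2" "i < 3"
  shows "card (triangle_edge k i) = k"
proof -
  have "Suc i mod 3 \<noteq> i" "Suc i mod 3 < 3"
    using assms(2) by (cases "Suc i = 3"; simp)+
  then have "card ({i, Suc i mod 3} \<union> {3 + i * (k - 2)..<3 + Suc i * (k - 2)}) = 2 + (k - 2)"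
    using assms(2) by (subst card_Un_disjoint) auto
  then show ?thesis
    using assms(1) by (simp add: triangle_edge_def)
qed

lemma linear_hgraph_hypercycle_3: "linear_hgraph (hypercycle k 3)"
  using triangle_edges_Int[of k]
  by (simp add: linear_hgraph_def hedges_hypercycle_3 Int_commute)

lemma hypercycle_3_meet:
  assumes "e \<in> hedges (hypercycle k 3)" "f \<in> hedges (hypercycle k 3)" "e \<noteq> f" "x \<in> e" "x \<in> f"
  shows "x \<in> {0, 1, 2}"
proof -
  have "e \<inter> f = {0} \<or> e \<inter> f = {1} \<or> e \<inter> f = {2}"
    using assms(1-3) triangle_edges_Int[of k] unfolding hedges_hypercycle_3
    by (elim insertE emptyE) (simp_all add: Int_commute)
  moreover have "x \<in> e \<inter> f"
    using assms(4,5) by simp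
  ultimately show ?thesis
    by (elim disjE) (simp_all only: singleton_iff insert_iff empty_iff simp_thms)
qed

lemma hypercycle_3_incident:
  "{g \<in> hedges (hypercycle k 3). 0 \<in> g} = {triangle_edge k 0, triangle_edge k 2}"
  "{g \<in> hedges (hypercycle k 3). 1 \<in> g} = {triangle_edge k 0, triangle_edge k 1}"
  "{g \<in> hedges (hypercycle k 3). 2 \<in> g} = {triangle_edge k 1, triangle_edge k 2}"
  unfolding hedges_hypercycle_3 by (auto simp: triangle_edge_iff)

text \<open>Only the corners 0, 1, 2 lie on more than one edge, each on exactly two, so a cycle uses
  both edges at each of its vertices. Linearity rules out length 2; hence all corners occur and
  every cycle has the incidence set \<open>?I\<close>.\<close>

lemma edge_unicyclic_hypercycle_3: "edge_unicyclic (hedges (hypercycle k 3))"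
proof -
  let ?E = "hedges (hypercycle k 3)"
  let ?T = "triangle_edge k"
  let ?I = "{(x, e). x \<in> {0, 1, 2} \<and> e \<in> ?E \<and> x \<in> e}"
  have E: "?E = {?T 0, ?T 1, ?T 2}"
    by (rule hedges_hypercycle_3)
  have tri: "edge_cycle ?E [0, 1, 2] [?T 0, ?T 1, ?T 2]"
  proof -
    let ?vs = "[0, 1, 2] :: nat list" and ?es = "[?T 0, ?T 1, ?T 2]"
    have len: "length ?vs = 3" "length ?es = 3"
      by simp_all
    have all3: "(\<forall>i<3::nat. P i) \<longleftrightarrow> P 0 \<and> P 1 \<and> P 2" for P
      by (auto simp: eval_nat_numeral less_Suc_eq)
    have "\<forall>i<3. ?vs ! i \<in> ?es ! i \<and> ?vs ! (Suc i mod 3) \<in> ?es ! i"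
      unfolding all3 by (simp add: triangle_edge_iff)
    then show ?thesis
      unfolding edge_cycle_def len using triangle_edges_distinct[of k] by (simp add: E)
  qed
  have uniq: "cycle_incidences vs es = ?I" if cyc: "edge_cycle ?E vs es" for vs es
  proof -
    have fin: "finite e" if "e \<in> ?E" for e
      using that unfolding E by (auto simp: triangle_edge_def)
    have two: "x \<in> {0, 1, 2} \<and> {g \<in> ?E. x \<in> g} = {e, f}"
      if ef: "e \<in> ?E" "f \<in> ?E" "e \<noteq> f" "x \<in> e" "x \<in> f" for e f x
    proof -
      have x: "x \<in> {0, 1, 2}"
        using hypercycle_3_meet[OF ef] .
      obtain a b where ab: "{g \<in> ?E. x \<in> g} = {a, b}"
        using x hypercycle_3_incident[of k] by blast
      have "e \<in> {a, b}" "f \<in> {a, b}"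
        unfolding ab[symmetric] using ef by blast+
      then have "{a, b} = {e, f}"
        using ef(3) by auto
      then show ?thesis
        using x ab by simp
    qed
    have all: "x \<in> {0, 1, 2} \<and> (\<forall>g\<in>?E. x \<in> g \<longrightarrow> (x, g) \<in> cycle_incidences vs es)"
      if x: "x \<in> set vs" for x
    proof -
      obtain e f where ef: "e \<noteq> f" "(x, e) \<in> cycle_incidences vs es" "(x, f) \<in> cycle_incidences vs es"
        using edge_cycle_vertex[OF cyc x] by blast
      then have S: "x \<in> {0, 1, 2}" "{g \<in> ?E. x \<in> g} = {e, f}"
        using two[of e f x] cycle_incidencesD[OF cyc, of x e] cycle_incidencesD[OF cyc, of x f]
        by auto
      have "(x, g) \<in> cycle_incidences vs es" if "g \<in> ?E" "x \<in> g" for g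
      proof -
        have "g \<in> {e, f}"
          unfolding S(2)[symmetric] using that by simp
        then show ?thesis
          using ef(2,3) by auto
      qed
      then show ?thesis
        using S(1) by simp
    qed
    have vs: "set vs = {0, 1, 2}"
    proof (rule card_subset_eq)
      show "set vs \<subseteq> {0, 1, 2}"
        using all by blast
      have len: "card (set vs) \<ge> 2" "card (set es) = card (set vs)"
        using cyc by (auto simp: edge_cycle_def distinct_card)
      \<comment> \<open>A cycle of length 2 would have two vertices on two common edges.\<close>
      have "card (set vs) \<noteq> 2"
      proof
        assume 2: "card (set vs) = 2"
        then obtain x y where xy: "set vs = {x, y}" "x \<noteq> y"
          by (auto simp: card_2_iff)
        obtain e f where ef: "set es = {e, f}" "e \<noteq> f"
          using 2 len(2) by (metis card_2_iff)
        have "x \<in> g \<and> y \<in> g \<and> g \<in> ?E" if g: "g \<in> set es" for g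
        proof -
          have "g \<in> ?E"
            using cyc g by (auto simp: edge_cycle_def)
          then show ?thesis
            using edge_cycle_edge[OF cyc g] xy by auto
        qed
        then show False
          using linear_hgraphD[OF linear_hgraph_hypercycle_3, of e k f x y] fin xy(2) ef by blast
      qed
      moreover have "card (set vs) \<le> 3"
        using card_mono[OF _ \<open>set vs \<subseteq> {0, 1, 2}\<close>] by simp
      ultimately show "card (set vs) = card {0, 1, 2::nat}"
        using len(1) by simp
    qed simp
    show ?thesis
    proof (rule Set.set_eqI)
      fix p :: "nat \<times> nat set"
      obtain x e where p: "p = (x, e)"
        by (cases p)
      show "p \<in> cycle_incidences vs es \<longleftrightarrow> p \<in> ?I"
        unfolding p using all[of x] cycle_incidencesD[OF cyc, of x e] unfolding vs by blast
    qed
  qed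
  show ?thesis
    unfolding edge_unicyclic_def
  proof (rule ex1I[of _ ?I])
    show "\<exists>vs es. edge_cycle ?E vs es \<and> ?I = cycle_incidences vs es"
      using tri uniq[OF tri] by (intro exI conjI) (assumption, rule sym)
  next
    fix C assume "\<exists>vs es. edge_cycle ?E vs es \<and> C = cycle_incidences vs es"
    then show "C = ?I"
      by (elim exE conjE) (simp only: uniq)
  qed
qed

lemma hypercycle_3_linear_unicyclic:
  assumes "k \<ge> 2"
  shows "hypercycle k 3 \<in> linear_unicyclic_class k 3"
proof -
  let ?H = "hypercycle k 3" and ?T = "triangle_edge k"
  have nv: "nverts ?H = 3 + 3 * (k - 2)"
    by (simp add: hypercycle_def)
  have "\<Union>(hedges ?H) = verts ?H"
    unfolding hedges_hypercycle_3 verts_def nv by (auto simp: triangle_edge_iff)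
  moreover have "edge_connected {?T 0}"
    by (auto simp: edge_connected_def edge_adj_def)
  then have "edge_connected {?T 1, ?T 0}"
    using edge_connected_insert[of "{?T 0}" 1 "?T 1"] by (simp add: triangle_edge_iff)
  then have "edge_connected {?T 2, ?T 1, ?T 0}"
    using edge_connected_insert[of "{?T 1, ?T 0}" 2 "?T 2"] by (simp add: triangle_edge_iff)
  then have "edge_connected (hedges ?H)"
    unfolding hedges_hypercycle_3 by (simp add: insert_commute)
  moreover have "card (hedges ?H) = 3"
    using triangle_edges_distinct[of k] by (simp add: hedges_hypercycle_3)
  moreover have "uniform_hgraph k ?H"
    using triangle_edge_card[OF assms] by (simp add: uniform_hgraph_def hedges_hypercycle_3)
  ultimately show ?thesis
    using linear_hgraph_hypercycle_3 edge_unicyclic_hypercycle_3 assms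
    by (auto simp: linear_unicyclic_class_iff wf_hgraph_def)
qed

lemma C3_pendant_linear_unicyclic:
  assumes "k \<ge> 2"
  shows "C3_pendant k n1 n2 n3 \<in> linear_unicyclic_class k (3 + n1 + n2 + n3)"
proof -
  \<comment> \<open>The corners are kept in the invariant so that every later pendant edge is
    attached to an existing vertex.\<close>
  let ?P = "\<lambda>m H. m \<ge> 1 \<and> H \<in> linear_unicyclic_class k m \<and> {0, 1, 2} \<subseteq> verts H"
  have step: "?P (m + i) ((add_pendant k v ^^ i) H)" if "?P m H" "v \<in> {0, 1, 2}" for v i m H
  proof (induction i)
    case (Suc i)
    let ?G = "(add_pendant k v ^^ i) H"
    have "v \<in> verts ?G"
      using Suc that(2) by blast
    moreover have "verts ?G \<subseteq> verts (add_pendant k v ?G)"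
      by (auto simp: verts_def)
    ultimately show ?case
      using Suc add_pendant_linear_unicyclic[OF assms, of "m + i" ?G v] by auto
  qed (use that in simp)
  have "{0, 1, 2} \<subseteq> verts (hypercycle k 3)"
    by (auto simp: verts_def hypercycle_def)
  then have "?P 3 (hypercycle k 3)"
    using hypercycle_3_linear_unicyclic[OF assms] by simp
  from step[OF this, of 0 n1] have "?P (3 + n1) ((add_pendant k 0 ^^ n1) (hypercycle k 3))"
    by blast
  from step[OF this, of 1 n2]
  have "?P (3 + n1 + n2) ((add_pendant k 1 ^^ n2) ((add_pendant k 0 ^^ n1) (hypercycle k 3)))"
    by blast
  from step[OF this, of 2 n3] show ?thesis
    unfolding C3_pendant_def by blast
qed

section \<open>Triangles with pendant hyperedges at two vertices\<close>

text \<open>A description independent of the numbering: \<open>e1\<close>, \<open>e2\<close>,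
  \<open>e3\<close> are the sides vu, uw, vw, and P and Q hold the pendant edges at v and at u. It
  can be verified for \<open>C3_pendant\<close> as well as for a hypergraph known only through its
  degrees, and it is strong enough to yield an isomorphism.\<close>

definition pendant_triangle :: "hgraph \<Rightarrow> nat \<Rightarrow> nat \<Rightarrow> nat \<Rightarrow> nat \<Rightarrow> nat \<Rightarrow> bool" where
  "pendant_triangle H v u w a b \<longleftrightarrow>
     v \<noteq> u \<and> u \<noteq> w \<and> v \<noteq> w \<and> {v, u, w} \<subseteq> verts H \<and>
     (\<forall>x\<in>verts H - {v, u, w}. vdegree H x = 1) \<and>
     (\<exists>e1 e2 e3 P Q. hedges H = {e1, e2, e3} \<union> P \<union> Q \<and>
        v \<in> e1 \<and> u \<in> e1 \<and> w \<notin> e1 \<and> v \<notin> e2 \<and> u \<in> e2 \<and> w \<in> e2 \<and> v \<in> e3 \<and> u \<notin> e3 \<and> w \<in> e3 \<and>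
        (\<forall>e\<in>P. v \<in> e \<and> u \<notin> e \<and> w \<notin> e) \<and> (\<forall>e\<in>Q. v \<notin> e \<and> u \<in> e \<and> w \<notin> e) \<and>
        finite P \<and> finite Q \<and> card P = a \<and> card Q = b)"

text \<open>The three sides and the two kinds of pendant edges have five different membership
  patterns, so the pattern counts depend only on a and b.\<close>

lemma pendant_triangle_count:
  assumes "pendant_triangle H v u w a b"
  shows "card {e \<in> hedges H. (v \<in> e, u \<in> e, w \<in> e) = t} =
    (if t \<in> {(True, True, False), (False, True, True), (True, False, True)} then 1
     else if t = (True, False, False) then a else if t = (False, True, False) then b else 0)"
proof -
  obtain e1 e2 e3 P Q where E: "hedges H = {e1, e2, e3} \<union> P \<union> Q"
    and m: "v \<in> e1" "u \<in> e1" "w \<notin> e1" "v \<notin> e2" "u \<in> e2" "w \<in> e2" "v \<in> e3" "u \<notin> e3" "w \<in> e3"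
    and P: "\<And>e. e \<in> P \<Longrightarrow> v \<in> e \<and> u \<notin> e \<and> w \<notin> e" "card P = a"
    and Q: "\<And>e. e \<in> Q \<Longrightarrow> v \<notin> e \<and> u \<in> e \<and> w \<notin> e" "card Q = b"
    using assms unfolding pendant_triangle_def by metis
  let ?f = "\<lambda>e. (v \<in> e, u \<in> e, w \<in> e)"
  have f: "?f e1 = (True, True, False)" "?f e2 = (False, True, True)" "?f e3 = (True, False, True)"
      "\<And>e. e \<in> P \<Longrightarrow> ?f e = (True, False, False)" "\<And>e. e \<in> Q \<Longrightarrow> ?f e = (False, True, False)"
    using m P Q by auto
  have "{e \<in> hedges H. ?f e = t} =
    (if t = (True, True, False) then {e1} else if t = (False, True, True) then {e2}
     else if t = (True, False, True) then {e3} else if t = (True, False, False) then P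
     else if t = (False, True, False) then Q else {})" (is "?L = ?R")
  proof (rule Set.set_eqI)
    fix e
    have "e \<in> ?L \<longleftrightarrow> (e = e1 \<and> ?f e1 = t \<or> e = e2 \<and> ?f e2 = t \<or> e = e3 \<and> ?f e3 = t \<or>
        e \<in> P \<and> ?f e = t \<or> e \<in> Q \<and> ?f e = t)"
      unfolding E by blast
    also have "\<dots> \<longleftrightarrow> (e = e1 \<and> (True, True, False) = t \<or> e = e2 \<and> (False, True, True) = t \<or>
        e = e3 \<and> (True, False, True) = t \<or> e \<in> P \<and> (True, False, False) = t \<or>
        e \<in> Q \<and> (False, True, False) = t)"
      using f by metis
    also have "\<dots> \<longleftrightarrow> e \<in> ?R"
      by (simp split: if_splits)
    finally show "e \<in> ?L \<longleftrightarrow> e \<in> ?R" .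
  qed
  then show ?thesis
    using P(2) Q(2) by simp
qed

lemma card_filter_split:
  assumes "finite A"
  shows "card {x \<in> A. p x} = card {x \<in> A. p x \<and> q x} + card {x \<in> A. p x \<and> \<not> q x}"
proof -
  have "{x \<in> A. p x} = {x \<in> A. p x \<and> q x} \<union> {x \<in> A. p x \<and> \<not> q x}"
    by blast
  also have "card \<dots> = card {x \<in> A. p x \<and> q x} + card {x \<in> A. p x \<and> \<not> q x}"
    using assms by (intro card_Un_disjoint) auto
  finally show ?thesis .
qed

lemma card_three_classes:
  assumes "finite A"
  shows "card {e \<in> A. p e} =
    card {e \<in> A. (p e, q e, r e) = (True, True, True)} + card {e \<in> A. (p e, q e, r e) = (True, True, False)} +
    card {e \<in> A. (p e, q e, r e) = (True, False, True)} + card {e \<in> A. (p e, q e, r e) = (True, False, False)}"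
  using card_filter_split[OF assms, of p q] card_filter_split[OF assms, of "\<lambda>e. p e \<and> q e" r]
    card_filter_split[OF assms, of "\<lambda>e. p e \<and> \<not> q e" r]
  by (simp add: conj_assoc)

text \<open>Lets \<open>pendant_triangle_count\<close>, stated for the order v, u, w, serve for the
  degrees of u and w as well.\<close>

lemma pendant_triangle_rotate:
  assumes "pendant_triangle H v u w a b"
  shows "card {e \<in> hedges H. (u \<in> e, v \<in> e, w \<in> e) = t} =
    card {e \<in> hedges H. (v \<in> e, u \<in> e, w \<in> e) = (fst (snd t), fst t, snd (snd t))}"
    "card {e \<in> hedges H. (w \<in> e, v \<in> e, u \<in> e) = t} =
    card {e \<in> hedges H. (v \<in> e, u \<in> e, w \<in> e) = (fst (snd t), snd (snd t), fst t)}"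
  by (cases t; rule arg_cong[where f = card]; auto)+

lemma pendant_triangle_finite: "pendant_triangle H v u w a b \<Longrightarrow> finite (hedges H)"
  unfolding pendant_triangle_def by auto

lemma pendant_triangle_vdegree:
  assumes "pendant_triangle H v u w a b"
  shows "vdegree H v = a + 2" "vdegree H u = b + 2" "vdegree H w = 2"
  unfolding vdegree_def
  using card_three_classes[OF pendant_triangle_finite[OF assms], of "\<lambda>e. v \<in> e" "\<lambda>e. u \<in> e" "\<lambda>e. w \<in> e"]
    card_three_classes[OF pendant_triangle_finite[OF assms], of "\<lambda>e. u \<in> e" "\<lambda>e. v \<in> e" "\<lambda>e. w \<in> e"]
    card_three_classes[OF pendant_triangle_finite[OF assms], of "\<lambda>e. w \<in> e" "\<lambda>e. v \<in> e" "\<lambda>e. u \<in> e"]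
  unfolding pendant_triangle_rotate[OF assms] pendant_triangle_count[OF assms] by simp_all

text \<open>The three corners contribute their squared degrees and each other vertex 1. The 3 stands
  on the left to avoid a truncated subtraction from \<open>nverts H\<close>.\<close>

lemma pendant_triangle_degree_square_sum:
  assumes "pendant_triangle H v u w a b"
  shows "degree_square_sum H + 3 = (a + 2)\<^sup>2 + (b + 2)\<^sup>2 + 4 + nverts H"
proof -
  let ?D = "{v, u, w}"
  have D: "v \<noteq> u" "u \<noteq> w" "v \<noteq> w" "?D \<subseteq> verts H" "\<And>x. x \<in> verts H - ?D \<Longrightarrow> vdegree H x = 1"
    using assms unfolding pendant_triangle_def by metis+
  have "card ?D = 3"
    using D(1-3) by simp
  then have card: "card (verts H - ?D) + 3 = nverts H"
    using card_Diff_subset[of ?D "verts H"] card_mono[OF finite_verts D(4)] D(4) by (simp add: verts_def)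
  have "degree_square_sum H = (\<Sum>x\<in>verts H - ?D. (vdegree H x)\<^sup>2) + (\<Sum>x\<in>?D. (vdegree H x)\<^sup>2)"
    unfolding degree_square_sum_def using D(4) by (rule sum.subset_diff) simp
  also have "(\<Sum>x\<in>verts H - ?D. (vdegree H x)\<^sup>2) = card (verts H - ?D)"
    using D(5) by simp
  also have "(\<Sum>x\<in>?D. (vdegree H x)\<^sup>2) = (a + 2)\<^sup>2 + (b + 2)\<^sup>2 + 4"
    using D(1-3) pendant_triangle_vdegree[OF assms] by simp
  finally show ?thesis
    using card by simp
qed

text \<open>Bijections between corresponding fibres glue together. This serves twice: for edges
  labelled by their pattern, and for vertices of degree one labelled by their edge.\<close>

lemma bij_betw_if_card_fibres_eq:
  assumes "finite A" "finite B"
    and card: "\<And>t. t \<in> f ` A \<union> g ` B \<Longrightarrow> card {a \<in> A. f a = t} = card {b \<in> B. g b = t}"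
  shows "\<exists>\<phi>. bij_betw \<phi> A B \<and> (\<forall>a\<in>A. g (\<phi> a) = f a)"
proof -
  have "\<exists>h. bij_betw h {a \<in> A. f a = t} {b \<in> B. g b = t}" if "t \<in> f ` A \<union> g ` B" for t
    using assms(1,2) card[OF that] by (intro finite_same_card_bij) auto
  then obtain h where h: "\<And>t. t \<in> f ` A \<union> g ` B \<Longrightarrow> bij_betw (h t) {a \<in> A. f a = t} {b \<in> B. g b = t}"
    by metis
  let ?\<phi> = "\<lambda>a. h (f a) a"
  have \<phi>: "?\<phi> a \<in> B \<and> g (?\<phi> a) = f a" if "a \<in> A" for a
    using bij_betw_apply[OF h[of "f a"], of a] that by auto
  have "inj_on ?\<phi> A"
  proof (rule inj_onI)
    fix a a' assume *: "a \<in> A" "a' \<in> A" "?\<phi> a = ?\<phi> a'"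
    then have "f a = f a'"
      using \<phi> by metis
    then show "a = a'"
      using inj_onD[OF bij_betw_imp_inj_on[OF h[of "f a"]], of a a'] * by auto
  qed
  moreover have "b \<in> ?\<phi> ` A" if "b \<in> B" for b
  proof -
    have "b \<in> h (g b) ` {a \<in> A. f a = g b}"
      using bij_betw_imp_surj_on[OF h[of "g b"]] that by auto
    then show ?thesis
      by force
  qed
  ultimately have "bij_betw ?\<phi> A B"
    using \<phi> by (auto simp: bij_betw_def)
  then show ?thesis
    using \<phi> by (intro exI[of _ ?\<phi>]) simp
qed

lemma vdegree_1_unique:
  assumes "vdegree H x = 1" "e \<in> hedges H" "x \<in> e"
  shows "{f \<in> hedges H. x \<in> f} = {e}"
proof -
  obtain g where "{f \<in> hedges H. x \<in> f} = {g}"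
    using assms(1) unfolding vdegree_def by (auto simp: card_1_singleton_iff)
  moreover have "e \<in> {f \<in> hedges H. x \<in> f}"
    using assms(2,3) by simp
  ultimately show ?thesis
    by simp
qed

lemma card_Diff_three:
  assumes "finite e" "v \<noteq> u" "u \<noteq> w" "v \<noteq> w"
  shows "card (e - {v, u, w}) = card e - (of_bool (v \<in> e) + of_bool (u \<in> e) + of_bool (w \<in> e))"
proof -
  have "e \<inter> {v, u, w} = (if v \<in> e then {v} else {}) \<union> (if u \<in> e then {u} else {}) \<union> (if w \<in> e then {w} else {})"
    by auto
  then have "card (e \<inter> {v, u, w}) = of_bool (v \<in> e) + of_bool (u \<in> e) + of_bool (w \<in> e)"
    using assms(2-4) by simp
  then show ?thesis
    using card_Diff_subset_Int[of e "{v, u, w}"] assms(1) by simp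
qed

text \<open>Edges are matched by pattern. The vertices other than the corners lie on one edge each
  and are matched edge by edge; this is possible because corresponding edges have k vertices and
  equally many corners.\<close>

lemma pendant_triangle_iso:
  assumes H: "pendant_triangle H v u w a b" "wf_hgraph H" "uniform_hgraph k H" "\<Union>(hedges H) = verts H"
    and G: "pendant_triangle G v' u' w' a b" "wf_hgraph G" "uniform_hgraph k G" "\<Union>(hedges G) = verts G"
    and k: "k \<ge> 2"
  shows "iso_hgraph H G"
proof -
  let ?E = "hedges H" and ?E' = "hedges G" and ?D = "{v, u, w}" and ?D' = "{v', u', w'}"
  have D: "v \<noteq> u" "u \<noteq> w" "v \<noteq> w" "?D \<subseteq> verts H" "\<And>x. x \<in> verts H - ?D \<Longrightarrow> vdegree H x = 1"
    using H(1) unfolding pendant_triangle_def by metis+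
  have D': "v' \<noteq> u'" "u' \<noteq> w'" "v' \<noteq> w'" "?D' \<subseteq> verts G" "\<And>x. x \<in> verts G - ?D' \<Longrightarrow> vdegree G x = 1"
    using G(1) unfolding pendant_triangle_def by metis+
  have fin: "finite e" if "e \<in> ?E \<union> ?E'" for e
    using that H(3) G(3) k by (auto simp: uniform_hgraph_def intro!: card_ge_0_finite)
  obtain \<phi> where \<phi>: "bij_betw \<phi> ?E ?E'"
      "\<And>e. e \<in> ?E \<Longrightarrow> (v' \<in> \<phi> e, u' \<in> \<phi> e, w' \<in> \<phi> e) = (v \<in> e, u \<in> e, w \<in> e)"
    using bij_betw_if_card_fibres_eq[OF finite_hedges[OF H(2)] finite_hedges[OF G(2)],
        of "\<lambda>e. (v \<in> e, u \<in> e, w \<in> e)" "\<lambda>e. (v' \<in> e, u' \<in> e, w' \<in> e)"]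
    unfolding pendant_triangle_count[OF H(1)] pendant_triangle_count[OF G(1)] by metis
  have \<phi>E: "\<phi> e \<in> ?E'" if "e \<in> ?E" for e
    using \<phi>(1) that by (rule bij_betw_apply)
  have inc: "{f \<in> ?E. x \<in> f} = {e}" if "x \<in> verts H - ?D" "e \<in> ?E" "x \<in> e" for x e
    using vdegree_1_unique[OF D(5)[OF that(1)] that(2,3)] .
  have inc': "{f \<in> ?E'. x \<in> f} = {e}" if "x \<in> verts G - ?D'" "e \<in> ?E'" "x \<in> e" for x e
    using vdegree_1_unique[OF D'(5)[OF that(1)] that(2,3)] .
  \<comment> \<open>A vertex is labelled by the set of its edges, transported to G by \<phi>.
    Outside the corners this is a singleton, so the edge itself need not be chosen.\<close>
  let ?f = "\<lambda>x. \<phi> ` {e \<in> ?E. x \<in> e}" and ?g = "\<lambda>y. {e \<in> ?E'. y \<in> e}"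
  let ?A = "verts H - ?D" and ?B = "verts G - ?D'"
  have fA: "?f x = {\<phi> e}" if "x \<in> ?A" "e \<in> ?E" "x \<in> e" for x e
    unfolding inc[OF that] by simp
  have gB: "?g y = {\<phi> e} \<longleftrightarrow> y \<in> \<phi> e" if "y \<in> ?B" "e \<in> ?E" for y e
    using inc'[OF that(1) \<phi>E[OF that(2)]] \<phi>E[OF that(2)] by blast
  have fA': "?f x = {\<phi> e} \<longleftrightarrow> x \<in> e" if x: "x \<in> ?A" and e: "e \<in> ?E" for x e
  proof
    assume *: "?f x = {\<phi> e}"
    obtain e' where e': "e' \<in> ?E" "x \<in> e'"
      using x H(4) by blast
    then have "\<phi> e' = \<phi> e"
      using fA[OF x e'] * by simp
    then have "e' = e"
      using bij_betw_imp_inj_on[OF \<phi>(1)] e e'(1) by (simp add: inj_on_eq_iff)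
    then show "x \<in> e"
      using e'(2) by simp
  qed (use fA[OF x e] in blast)
  have fibres: "card {x \<in> ?A. ?f x = t} = card {y \<in> ?B. ?g y = t}" if t: "t \<in> ?f ` ?A \<union> ?g ` ?B" for t
  proof -
    have "\<exists>e\<in>?E. t = {\<phi> e}"
    proof (cases "t \<in> ?f ` ?A")
      case True
      then obtain x where x: "x \<in> ?A" "t = ?f x"
        by blast
      then obtain e where e: "e \<in> ?E" "x \<in> e"
        using H(4) by blast
      then show ?thesis
        using fA[OF x(1) e] x(2) by blast
    next
      case False
      then obtain y where y: "y \<in> ?B" "t = ?g y"
        using t by blast
      then obtain e' where e': "e' \<in> ?E'" "y \<in> e'"
        using G(4) by blast
      then obtain e where "e \<in> ?E" "e' = \<phi> e"
        using bij_betw_imp_surj_on[OF \<phi>(1)] by blast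
      then show ?thesis
        using inc'[OF y(1) e'] y(2) by blast
    qed
    then obtain e where e: "e \<in> ?E" "t = {\<phi> e}"
      by blast
    have "{x \<in> ?A. ?f x = t} = {x \<in> ?A. x \<in> e}"
      unfolding e(2) by (intro Collect_cong conj_cong refl fA'[OF _ e(1)])
    also have "\<dots> = e - ?D"
      using e(1) H(4) by blast
    finally have "{x \<in> ?A. ?f x = t} = e - ?D" .
    moreover have "{y \<in> ?B. ?g y = t} = {y \<in> ?B. y \<in> \<phi> e}"
      unfolding e(2) by (intro Collect_cong conj_cong refl gB[OF _ e(1)])
    then have "{y \<in> ?B. ?g y = t} = \<phi> e - ?D'"
      using \<phi>E[OF e(1)] G(4) by blast
    moreover have "card e = k" "card (\<phi> e) = k"
      using H(3) G(3) e(1) \<phi>E[OF e(1)] by (auto simp: uniform_hgraph_def)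
    ultimately show ?thesis
      using \<phi>(2)[OF e(1)] D(1-3) D'(1-3) e(1) \<phi>E[OF e(1)] fin by (simp add: card_Diff_three)
  qed
  from bij_betw_if_card_fibres_eq[of ?A ?B ?f ?g, OF _ _ fibres]
  obtain \<beta> where \<beta>: "bij_betw \<beta> ?A ?B" "\<And>x. x \<in> ?A \<Longrightarrow> ?g (\<beta> x) = ?f x"
    by auto
  define F where "F x = (if x = v then v' else if x = u then u' else if x = w then w' else \<beta> x)" for x
  have "bij_betw F ?D ?D'"
    using D(1-3) D'(1-3) by (auto simp: bij_betw_def inj_on_def F_def)
  moreover have "bij_betw F ?A ?B"
    using \<beta>(1) by (rule iffD2[OF bij_betw_cong, rotated]) (auto simp: F_def)
  ultimately have "bij_betw F (?D \<union> ?A) (?D' \<union> ?B)"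
    by (intro bij_betw_combine) auto
  then have bij: "bij_betw F (verts H) (verts G)"
    unfolding Un_Diff_cancel Un_absorb1[OF D(4)] Un_absorb1[OF D'(4)] .
  \<comment> \<open>Inclusion suffices, since both sides have k elements.\<close>
  have "F ` e = \<phi> e" if e: "e \<in> ?E" for e
  proof (rule card_subset_eq)
    show "finite (\<phi> e)"
      using fin \<phi>E[OF e] by blast
    show "F ` e \<subseteq> \<phi> e"
    proof
      fix y assume "y \<in> F ` e"
      then obtain x where x: "x \<in> e" "y = F x"
        by blast
      show "y \<in> \<phi> e"
      proof (cases "x \<in> ?D")
        case True
        then show ?thesis
          using \<phi>(2)[OF e] x D(1-3) by (auto simp: F_def)
      next
        case False
        then have xA: "x \<in> ?A"
          using x(1) e H(4) by blast
        have "?g (\<beta> x) = {\<phi> e}"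
          using \<beta>(2)[OF xA] fA[OF xA e x(1)] by simp
        then show ?thesis
          using False x(2) by (auto simp: F_def)
      qed
    qed
    have "inj_on F e"
      using bij_betw_imp_inj_on[OF bij] by (rule inj_on_subset) (use e H(4) in blast)
    then show "card (F ` e) = card (\<phi> e)"
      using H(3) G(3) e \<phi>E[OF e] by (simp add: card_image uniform_hgraph_def)
  qed
  then have "(\<lambda>e. F ` e) ` ?E = \<phi> ` ?E"
    by (rule image_cong[OF refl])
  also have "\<dots> = ?E'"
    using \<phi>(1) by (rule bij_betw_imp_surj_on)
  finally show ?thesis
    unfolding iso_hgraph_def using bij by (intro exI[of _ F] conjI)
qed

text \<open>Needed to tell the two extremal hypergraphs apart: different sums exclude an
  isomorphism.\<close>

lemma iso_hgraph_degree_square_sum: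
  assumes "iso_hgraph H G" "wf_hgraph H"
  shows "degree_square_sum H = degree_square_sum G"
proof -
  obtain f where f: "bij_betw f (verts H) (verts G)" "(\<lambda>e. f ` e) ` hedges H = hedges G"
    using assms(1) unfolding iso_hgraph_def by blast
  have inj: "inj_on f (verts H)"
    using f(1) by (rule bij_betw_imp_inj_on)
  have sub: "e \<subseteq> verts H" if "e \<in> hedges H" for e
    using assms(2) that by (simp add: wf_hgraph_def)
  have "vdegree G (f x) = vdegree H x" if x: "x \<in> verts H" for x
  proof -
    have "f x \<in> f ` e \<longleftrightarrow> x \<in> e" if "e \<in> hedges H" for e
      using inj_on_image_mem_iff[OF inj x sub[OF that]] .
    then have "{e' \<in> hedges G. f x \<in> e'} = (\<lambda>e. f ` e) ` {e \<in> hedges H. x \<in> e}"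
      unfolding f(2)[symmetric] by blast
    moreover have "inj_on (\<lambda>e. f ` e) {e \<in> hedges H. x \<in> e}"
      using inj_on_image_eq_iff[OF inj] sub by (auto simp: inj_on_def)
    ultimately show ?thesis
      unfolding vdegree_def by (simp add: card_image)
  qed
  then show ?thesis
    unfolding degree_square_sum_def using sum.reindex_bij_betw[OF f(1), of "\<lambda>y. (vdegree G y)\<^sup>2"]
    by simp
qed

section \<open>The hypergraphs \<open>C3_pendant\<close> as pendant triangles\<close>

lemma pendant_triangleI:
  assumes "v \<noteq> u" "u \<noteq> w" "v \<noteq> w" "v \<in> verts H" "u \<in> verts H" "w \<in> verts H"
    and "\<And>x. x \<in> verts H - {v, u, w} \<Longrightarrow> vdegree H x = 1"
    and "hedges H = {e1, e2, e3} \<union> P \<union> Q"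
    and "v \<in> e1" "u \<in> e1" "w \<notin> e1" "v \<notin> e2" "u \<in> e2" "w \<in> e2" "v \<in> e3" "u \<notin> e3" "w \<in> e3"
    and "\<And>e. e \<in> P \<Longrightarrow> v \<in> e \<and> u \<notin> e \<and> w \<notin> e" "\<And>e. e \<in> Q \<Longrightarrow> v \<notin> e \<and> u \<in> e \<and> w \<notin> e"
    and "finite P" "finite Q" "card P = a" "card Q = b"
  shows "pendant_triangle H v u w a b"
proof -
  have "\<exists>e1 e2 e3 P Q. hedges H = {e1, e2, e3} \<union> P \<union> Q \<and>
        v \<in> e1 \<and> u \<in> e1 \<and> w \<notin> e1 \<and> v \<notin> e2 \<and> u \<in> e2 \<and> w \<in> e2 \<and> v \<in> e3 \<and> u \<notin> e3 \<and> w \<in> e3 \<and>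
        (\<forall>e\<in>P. v \<in> e \<and> u \<notin> e \<and> w \<notin> e) \<and> (\<forall>e\<in>Q. v \<notin> e \<and> u \<in> e \<and> w \<notin> e) \<and>
        finite P \<and> finite Q \<and> card P = a \<and> card Q = b"
    by (rule exI[of _ e1], rule exI[of _ e2], rule exI[of _ e3], rule exI[of _ P], rule exI[of _ Q])
      (use assms(8-) in blast)
  with assms(1-7) show ?thesis
    by (simp add: pendant_triangle_def)
qed

lemma vdegree_add_pendant:
  assumes "wf_hgraph H" "k \<ge> 2" "v \<in> verts H" "x \<in> verts (add_pendant k v H) - {v}"
  shows "vdegree (add_pendant k v H) x = (if x \<in> verts H then vdegree H x else 1)"
proof -
  let ?N = "insert v {nverts H..<nverts H + (k - 1)}"
  have "{e \<in> hedges (add_pendant k v H). x \<in> e} =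
      (if x \<in> verts H then {e \<in> hedges H. x \<in> e} else {?N})"
    using assms by (auto simp: hedges_add_pendant verts_def wf_hgraph_def)
  then show ?thesis
    by (simp add: vdegree_def)
qed

lemma pendant_triangle_add_pendant:
  assumes "pendant_triangle H v u w a b" "wf_hgraph H" "k \<ge> 2"
  shows "pendant_triangle (add_pendant k v H) v u w (Suc a) b"
    and "pendant_triangle (add_pendant k u H) v u w a (Suc b)"
proof -
  have D: "v \<noteq> u" "u \<noteq> w" "v \<noteq> w" "{v, u, w} \<subseteq> verts H"
      "\<And>x. x \<in> verts H - {v, u, w} \<Longrightarrow> vdegree H x = 1"
    using assms(1) unfolding pendant_triangle_def by metis+
  obtain e1 e2 e3 P Q where E: "hedges H = {e1, e2, e3} \<union> P \<union> Q"
    and m: "v \<in> e1 \<and> u \<in> e1 \<and> w \<notin> e1 \<and> v \<notin> e2 \<and> u \<in> e2 \<and> w \<in> e2 \<and> v \<in> e3 \<and> u \<notin> e3 \<and> w \<in> e3"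
    and P: "\<forall>e\<in>P. v \<in> e \<and> u \<notin> e \<and> w \<notin> e" "finite P" "card P = a"
    and Q: "\<forall>e\<in>Q. v \<notin> e \<and> u \<in> e \<and> w \<notin> e" "finite Q" "card Q = b"
    using assms(1) unfolding pendant_triangle_def by metis
  define N where "N z = insert z {nverts H..<nverts H + (k - 1)}" for z
  have N: "N z \<notin> hedges H" for z
    unfolding N_def by (rule pendant_edge_not_in_hedges[OF assms(2,3)])
  have Nm: "x \<in> N z \<longleftrightarrow> x = z" if "x \<in> verts H" for x z
    using that by (auto simp: N_def verts_def)
  have E': "hedges (add_pendant k z H) = insert (N z) (hedges H)" for z
    by (simp add: hedges_add_pendant N_def)
  have sub: "{v, u, w} \<subseteq> verts (add_pendant k z H)" for z
    using D(4) by (auto simp: verts_def)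
  have deg: "\<forall>x\<in>verts (add_pendant k z H) - {v, u, w}. vdegree (add_pendant k z H) x = 1"
    if "z \<in> {v, u}" for z
  proof
    fix x assume x: "x \<in> verts (add_pendant k z H) - {v, u, w}"
    have "z \<in> verts H" "x \<in> verts (add_pendant k z H) - {z}"
      using that x D(4) by blast+
    then show "vdegree (add_pendant k z H) x = 1"
      using vdegree_add_pendant[OF assms(2,3)] D(5)[of x] x by auto
  qed
  have "\<forall>e\<in>insert (N v) P. v \<in> e \<and> u \<notin> e \<and> w \<notin> e"
    using P(1) Nm D(1-4) by auto
  moreover have "hedges (add_pendant k v H) = {e1, e2, e3} \<union> insert (N v) P \<union> Q"
    unfolding E' E by blast
  moreover have "card (insert (N v) P) = Suc a" "finite (insert (N v) P)"
    using P(2,3) N[of v] unfolding E by auto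
  ultimately show "pendant_triangle (add_pendant k v H) v u w (Suc a) b"
    unfolding pendant_triangle_def
    using D(1-3) sub[of v] deg[of v] m Q by blast
  have "\<forall>e\<in>insert (N u) Q. v \<notin> e \<and> u \<in> e \<and> w \<notin> e"
    using Q(1) Nm D(1-4) by auto
  moreover have "hedges (add_pendant k u H) = {e1, e2, e3} \<union> P \<union> insert (N u) Q"
    unfolding E' E by blast
  moreover have "card (insert (N u) Q) = Suc b" "finite (insert (N u) Q)"
    using Q(2,3) N[of u] unfolding E by auto
  ultimately show "pendant_triangle (add_pendant k u H) v u w a (Suc b)"
    unfolding pendant_triangle_def
    using D(1-3) sub[of u] deg[of u] m P by blast
qed

lemma pendant_triangle_hypercycle_3:
  assumes "k \<ge> 2"
  shows "pendant_triangle (hypercycle k 3) 0 1 2 0 0"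
proof -
  let ?H = "hypercycle k 3" and ?T = "triangle_edge k"
  have "vdegree ?H x = 1" if x: "x \<in> verts ?H - {0, 1, 2}" for x
  proof -
    have "\<Union>(hedges ?H) = verts ?H"
      using hypercycle_3_linear_unicyclic[OF assms] linear_unicyclic_class_iff[OF assms, of 3 ?H] by simp
    then obtain e where e: "e \<in> hedges ?H" "x \<in> e"
      using x by blast
    then have "{f \<in> hedges ?H. x \<in> f} = {e}"
      using hypercycle_3_meet[of e k _ x] x by blast
    then show ?thesis
      by (simp add: vdegree_def)
  qed
  moreover have "{0, 1, 2} \<subseteq> verts ?H"
    by (auto simp: verts_def hypercycle_def)
  moreover have "0 \<in> ?T 0 \<and> 1 \<in> ?T 0 \<and> 2 \<notin> ?T 0 \<and> 0 \<notin> ?T 1 \<and> 1 \<in> ?T 1 \<and> 2 \<in> ?T 1 \<and>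
      0 \<in> ?T 2 \<and> 1 \<notin> ?T 2 \<and> 2 \<in> ?T 2"
    by (simp add: triangle_edge_iff)
  moreover have "hedges ?H = {?T 0, ?T 1, ?T 2} \<union> {} \<union> {}"
    by (simp add: hedges_hypercycle_3)
  ultimately show ?thesis
    by (intro pendant_triangleI[of 0 1 2 ?H "?T 0" "?T 1" "?T 2" "{}" "{}"]) (simp_all only: card.empty finite.emptyI, auto)
qed

lemma pendant_triangle_C3_pendant:
  assumes "k \<ge> 2"
  shows "pendant_triangle (C3_pendant k n1 n2 0) 0 1 2 n1 n2"
proof -
  have wf: "wf_hgraph (C3_pendant k i j 0)" for i j
    using C3_pendant_linear_unicyclic[OF assms, of i j 0] by (simp add: linear_unicyclic_class_def)
  have "pendant_triangle (C3_pendant k n1 0 0) 0 1 2 n1 0"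
  proof (induction n1)
    case (Suc i)
    then show ?case
      using pendant_triangle_add_pendant(1)[OF Suc wf assms] by (simp add: C3_pendant_def)
  qed (simp add: C3_pendant_def pendant_triangle_hypercycle_3[OF assms, unfolded One_nat_def])
  then show ?thesis
  proof (induction n2)
    case (Suc j)
    then show ?case
      using pendant_triangle_add_pendant(2)[OF Suc.IH[OF Suc.prems] wf assms]
      by (simp add: C3_pendant_def)
  qed
qed

section \<open>Classification by degree sequences\<close>

lemma sum_squares_le:
  fixes x :: "'a \<Rightarrow> nat"
  assumes "finite A" "sum x A = s" "\<And>u. u \<in> A \<Longrightarrow> x u \<le> s - 1" "s \<ge> 2"
  shows "(\<Sum>u\<in>A. (x u)\<^sup>2) \<le> (s - 1)\<^sup>2 + 1"
proof (cases "\<exists>y\<in>A. x y = s - 1")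
  case True
  then obtain y where y: "y \<in> A" "x y = s - 1"
    by blast
  have rest: "sum x (A - {y}) = 1"
    using sum.remove[OF assms(1) y(1), of x] assms(2,4) y(2) by simp
  have "(x u)\<^sup>2 = x u" if "u \<in> A - {y}" for u
  proof -
    have "x u \<le> sum x (A - {y})"
      using assms(1) that by (intro member_le_sum) auto
    then have "x u = 0 \<or> x u = 1"
      using rest by linarith
    then show ?thesis
      by auto
  qed
  then have "(\<Sum>u\<in>A - {y}. (x u)\<^sup>2) = 1"
    using rest by simp
  then show ?thesis
    using sum.remove[OF assms(1) y(1), of "\<lambda>u. (x u)\<^sup>2"] y(2) by simp
next
  case False
  \<comment> \<open>Now all values are at most r = s - 2, so the squares sum to at most (s - 2) s =
    (s - 1)^2 - 1.\<close>
  obtain r where r: "s = r + 2"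
    using assms(4) by (metis add.commute le_Suc_ex)
  have "x u \<le> r" if "u \<in> A" for u
    using assms(3)[OF that] False that r by force
  then have "(\<Sum>u\<in>A. (x u)\<^sup>2) \<le> (\<Sum>u\<in>A. r * x u)"
    unfolding power2_eq_square by (intro sum_mono mult_right_mono) auto
  also have "\<dots> = r * s"
    using assms(2) by (simp flip: sum_distrib_left)
  also have "\<dots> \<le> (s - 1)\<^sup>2 + 1"
    unfolding r power2_eq_square by simp
  finally show ?thesis .
qed

text \<open>The bound is the sum of squares of m - 3, 2, 1. With the maximum at most m - 4, the
  other values total some s \<ge> 4 and are at most s - 1 by \<open>pair\<close>, so
  \<open>sum_squares_le\<close> can be applied to them.\<close>

lemma sum_squares_less:
  fixes x :: "'a \<Rightarrow> nat"
  assumes "finite V" "sum x V = m" "m \<ge> 5" "v \<in> V" "\<And>u. u \<in> V \<Longrightarrow> x u \<le> x v" "x v + 4 \<le> m"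
    and pair: "\<And>u. u \<in> V \<Longrightarrow> u \<noteq> v \<Longrightarrow> x v + x u + 1 \<le> m"
  shows "(\<Sum>u\<in>V. (x u)\<^sup>2) < (m - 3)\<^sup>2 + 5"
\<comment> \<open>For \<open>x v = 2\<close> that estimate gives 4 + (s - 1)^2 + 1, exactly the
  bound because m - 3 = s - 1, so strictness is lost. Small maxima are treated by bounding each
  square by \<open>x v * x u\<close>.\<close>
proof (cases "x v \<le> 2")
  case True
  have "(\<Sum>u\<in>V. (x u)\<^sup>2) \<le> (\<Sum>u\<in>V. x v * x u)"
    unfolding power2_eq_square using assms(5) by (intro sum_mono mult_right_mono) auto
  also have "\<dots> = x v * m"
    using assms(2) by (simp flip: sum_distrib_left)
  also have "\<dots> < (m - 3)\<^sup>2 + 5"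
  proof -
    obtain r where r: "m = r + 5"
      using assms(3) by (metis add.commute le_Suc_ex)
    consider "x v = 0" | "x v = 1" | "x v = 2"
      using True by linarith
    then show ?thesis
    proof cases
      case 3
      \<comment> \<open>Here \<open>x v + 4 \<le> m\<close> forces m \<ge> 6; at m = 5 the
        inequality 2 m < (m - 3)^2 + 5 would be false.\<close>
      then obtain q where q: "r = Suc q"
        using assms(6) r by (cases r) auto
      show ?thesis
        unfolding 3 r q power2_eq_square by (simp add: algebra_simps)
    qed (simp_all add: r power2_eq_square algebra_simps)
  qed
  finally show ?thesis .
next
  case False
  define s where "s = m - x v"
  have s: "m = x v + s" "s \<ge> 4"
    using assms(6) by (simp_all add: s_def)
  have "sum x (V - {v}) = s"
    using sum.remove[OF assms(1,4), of x] assms(2) s(1) by simp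
  moreover have "x u \<le> s - 1" if "u \<in> V - {v}" for u
    using pair[of u] that s by simp
  ultimately have rest: "(\<Sum>u\<in>V - {v}. (x u)\<^sup>2) \<le> (s - 1)\<^sup>2 + 1"
    using assms(1) s(2) by (intro sum_squares_le) auto
  obtain r where r: "s = r + 4"
    using s(2) by (metis add.commute le_Suc_ex)
  obtain q where q: "x v = q + 3"
    using False by (metis add.commute le_Suc_ex not_less_eq_eq eval_nat_numeral(3) numeral_3_eq_3 Suc_1)
  have "(x v)\<^sup>2 + ((s - 1)\<^sup>2 + 1) < (m - 3)\<^sup>2 + 5"
    unfolding s(1) r q power2_eq_square by (simp add: algebra_simps)
  then show ?thesis
    using rest sum.remove[OF assms(1,4), of "\<lambda>u. (x u)\<^sup>2"] by simp
qed

section \<open>Degrees and excesses in the class\<close>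

locale linear_unicyclic =
  fixes H :: hgraph and k m :: nat
  assumes k: "k \<ge> 2" and m: "m \<ge> 5" and H: "H \<in> linear_unicyclic_class k m"
begin

abbreviation "V \<equiv> verts H"
abbreviation "E \<equiv> hedges H"
abbreviation "star v \<equiv> {e \<in> E. v \<in> e}"
abbreviation "excess v \<equiv> vdegree H v - 1"

lemma wf: "wf_hgraph H" and unif: "uniform_hgraph k H" and lin: "linear_hgraph H"
  and Union_E: "\<Union>E = V" and card_E: "card E = m"
  using H k m linear_unicyclic_class_iff[of k m H] by simp_all

lemma nverts: "nverts H = m * (k - 1)"
  using H k m linear_unicyclic_nverts[of k m H] by simp

lemma fin_E: "finite E"
  using wf by (rule finite_hedges)

lemma fin_edge: "e \<in> E \<Longrightarrow> finite e"
  using unif k by (auto simp: uniform_hgraph_def intro!: card_ge_0_finite)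

lemma unique_edge: "e \<in> E \<Longrightarrow> f \<in> E \<Longrightarrow> x \<in> e \<Longrightarrow> x \<in> f \<Longrightarrow> y \<in> e \<Longrightarrow> y \<in> f \<Longrightarrow> x \<noteq> y \<Longrightarrow> e = f"
  using linear_hgraphD[OF lin _ _ fin_edge] by blast

lemma vdegree_pos: "v \<in> V \<Longrightarrow> vdegree H v \<ge> 1"
  unfolding vdegree_def Union_E[symmetric] using fin_E by (auto simp: Suc_le_eq card_gt_0_iff)

text \<open>The degrees sum to k m over m (k - 1) vertices; subtracting 1 per vertex leaves m. The
  subtraction is never truncated, by \<open>vdegree_pos\<close>.\<close>

lemma sum_excess: "(\<Sum>v\<in>V. excess v) = m"
proof -
  have "(\<Sum>v\<in>V. vdegree H v) = (\<Sum>v\<in>V. excess v + 1)"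
    by (rule sum.cong[OF refl]) (use vdegree_pos in \<open>simp del: One_nat_def\<close>)
  then have "k * m = (\<Sum>v\<in>V. excess v) + card V"
    unfolding sum_vdegree[OF wf unif] card_E by (simp only: sum.distrib sum_constant mult_1_right of_nat_id)
  moreover have "card V = m * (k - 1)"
    by (simp add: verts_def nverts)
  moreover have "k * m = m + m * (k - 1)"
    using k by (cases k) auto
  ultimately show ?thesis
    by simp
qed

text \<open>From d^2 = (d - 1)^2 + 2 (d - 1) + 1, where the last two terms sum to constants of the
  class.\<close>

lemma degree_square_sum_excess: "degree_square_sum H = (\<Sum>v\<in>V. (excess v)\<^sup>2) + 2 * m + nverts H"
proof -
  have "degree_square_sum H = (\<Sum>v\<in>V. ((excess v)\<^sup>2 + 2 * excess v) + 1)"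
    unfolding degree_square_sum_def
  proof (rule sum.cong[OF refl])
    fix v assume "v \<in> V"
    then obtain d where "vdegree H v = Suc d"
      using vdegree_pos[of v] by (cases "vdegree H v") auto
    then show "(vdegree H v)\<^sup>2 = ((excess v)\<^sup>2 + 2 * excess v) + 1"
      by (simp add: power2_eq_square)
  qed
  also have "\<dots> = (\<Sum>v\<in>V. (excess v)\<^sup>2) + 2 * (\<Sum>v\<in>V. excess v) + card V"
    by (simp only: sum.distrib sum_distrib_left[symmetric] sum_constant mult_1_right of_nat_id)
  finally show ?thesis
    unfolding sum_excess by (simp add: verts_def)
qed

lemma card_common: "u \<noteq> v \<Longrightarrow> card (star u \<inter> star v) \<le> 1"
proof -
  assume "u \<noteq> v"
  then have "e = f" if "e \<in> star u \<inter> star v" "f \<in> star u \<inter> star v" for e f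
    using that unique_edge[of e f u v] by blast
  then show ?thesis
    using card_le_Suc0_iff_eq[of "star u \<inter> star v"] fin_E by auto
qed

text \<open>Inclusion-exclusion on the edges at u and at v, of which linearity allows at most one in
  common.\<close>

lemma vdegree_pair: "u \<noteq> v \<Longrightarrow> vdegree H u + vdegree H v \<le> m + 1"
proof -
  assume "u \<noteq> v"
  have "vdegree H u + vdegree H v = card (star u \<union> star v) + card (star u \<inter> star v)"
    unfolding vdegree_def using fin_E by (intro card_Un_Int) auto
  moreover have "card (star u \<union> star v) \<le> m"
    unfolding card_E[symmetric] using fin_E by (intro card_mono) auto
  ultimately show ?thesis
    using card_common[OF \<open>u \<noteq> v\<close>] by simp
qed

lemma vdegree_le: "vdegree H v \<le> m"
  unfolding vdegree_def card_E[symmetric] using fin_E by (intro card_mono) auto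

lemma card_avoiding: "card (E - star v) = m - vdegree H v"
  unfolding vdegree_def card_E[symmetric] using fin_E by (intro card_Diff_subset) auto

lemma star_eqI:
  assumes "vdegree H u = card F" "finite F" "star u \<subseteq> F"
  shows "star u = F"
  using assms card_subset_eq[of F "star u"] by (simp add: vdegree_def)

text \<open>A vertex on every edge would leave all others with excess 0, and the total would be m -
  1 instead of m.\<close>

lemma vdegree_less:
  assumes "v \<in> V"
  shows "vdegree H v < m"
proof (rule ccontr)
  assume "\<not> ?thesis"
  then have d: "vdegree H v = m"
    using vdegree_le[of v] by simp
  have "excess u = 0" if "u \<in> V - {v}" for u
    using vdegree_pair[of u v] that d by simp
  then have "(\<Sum>u\<in>V - {v}. excess u) = 0"
    by simp
  then have "m = m - 1"
    using sum.remove[OF finite_verts assms, of excess] sum_excess d by simp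
  then show False
    using m by simp
qed

text \<open>Apart from at most one edge joining u to v, the edges at u avoid v. This determines the
  star of u when few edges avoid v.\<close>

lemma star_decompose:
  assumes "u \<in> V" "u \<noteq> v"
  obtains h where "star u \<subseteq> insert h (E - star v)" "h \<in> star u \<inter> star v"
  | "star u \<subseteq> E - star v"
proof (cases "star u \<inter> star v = {}")
  case True
  then show ?thesis
    using that(2) by blast
next
  case False
  then obtain h where h: "h \<in> star u \<inter> star v"
    by blast
  have "e = h" if "e \<in> star u \<inter> star v" for e
    using h that unique_edge[of e h u v] assms(2) by blast
  then show ?thesis
    using that(1)[of h] h by blast
qed

text \<open>Exactly one edge e avoids v. The remaining excess is 2 and no other vertex has more than
  1, so two vertices u, w have degree 2. Each lies on e and on an edge through v; these two edges
  differ, since e already contains both u and w.\<close>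

lemma pendant_triangle_if_vdegree_max:
  assumes v: "v \<in> V" "vdegree H v = m - 1"
  shows "\<exists>u w. pendant_triangle H v u w (m - 3) 0"
proof -
  let ?x = excess
  obtain e where e: "E - star v = {e}"
    using card_avoiding[of v] v(2) m by (auto simp: card_1_singleton_iff)
  have le1: "?x u = 0 \<or> ?x u = 1" if "u \<in> V - {v}" for u
    using vdegree_pair[of u v] that v(2) m by auto
  have rest: "(\<Sum>u\<in>V - {v}. ?x u) = 2"
    using sum.remove[OF finite_verts v(1), of ?x] sum_excess v(2) m by simp
  let ?U = "{u \<in> V - {v}. ?x u = 1}"
  have "(\<Sum>u\<in>V - {v}. ?x u) = (\<Sum>u\<in>V - {v}. if ?x u = 1 then 1 else 0)"
    using le1 by (intro sum.cong) auto
  also have "\<dots> = card ?U"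
    by (subst sum.If_cases) (auto simp: Int_def)
  finally obtain u w where uw: "?U = {u, w}" "u \<noteq> w"
    using rest by (metis card_2_iff)
  have U: "u' \<noteq> v \<and> u' \<in> V \<and> vdegree H u' = 2" if "u' \<in> {u, w}" for u'
  proof -
    have "u' \<in> ?U"
      unfolding uw(1) using that .
    then show ?thesis
      by auto
  qed
  have deg1: "vdegree H x = 1" if "x \<in> V - {v, u, w}" for x
  proof -
    have "x \<notin> ?U"
      unfolding uw(1) using that by blast
    then show ?thesis
      using that le1[of x] vdegree_pos[of x] by auto
  qed
  have stars: "\<exists>h. star u' = {h, e} \<and> v \<in> h \<and> h \<in> E" if u': "u' \<in> {u, w}" for u'
  proof -
    note U' = U[OF u']
    show ?thesis
    proof (rule star_decompose[of u' v])
      fix h assume h: "star u' \<subseteq> insert h (E - star v)" "h \<in> star u' \<inter> star v"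
      then have "h \<noteq> e"
        using e by blast
      then have "star u' = {h, e}"
        using h(1) U' unfolding e by (intro star_eqI) auto
      then show ?thesis
        using h(2) by blast
    next
      assume "star u' \<subseteq> E - star v"
      then have "card (star u') \<le> card {e}"
        unfolding e by (intro card_mono) auto
      then show ?thesis
        using U' by (simp add: vdegree_def)
    qed (use U' in auto)
  qed
  obtain h1 where h1: "star u = {h1, e}" "v \<in> h1" "h1 \<in> E"
    using stars[of u] by auto
  obtain h2 where h2: "star w = {h2, e}" "v \<in> h2" "h2 \<in> E"
    using stars[of w] by auto
  have "v \<notin> e" "e \<in> E"
    using e by blast+
  have ue: "u \<in> e" "u \<in> h1" and we: "w \<in> e" "w \<in> h2"
    using h1(1) h2(1) by blast+
  have "h1 \<noteq> e" "h2 \<noteq> e"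
    using h1 h2 \<open>v \<notin> e\<close> by auto
  have "h1 \<noteq> h2"
    using unique_edge[of h1 e u w] h1(3) \<open>e \<in> E\<close> ue we uw(2) \<open>h1 \<noteq> e\<close> by blast
  have "u \<notin> h2" "w \<notin> h1"
    using h1 h2 \<open>h1 \<noteq> h2\<close> \<open>h1 \<noteq> e\<close> \<open>h2 \<noteq> e\<close> by blast+
  let ?P = "E - {h1, e, h2}"
  have P: "v \<in> f \<and> u \<notin> f \<and> w \<notin> f" if "f \<in> ?P" for f
  proof -
    have "f \<notin> star u" "f \<notin> star w" "f \<notin> E - star v"
      unfolding h1(1) h2(1) e using that by simp_all
    then show ?thesis
      using that by simp
  qed
  have "card {h1, e, h2} = 3"
    using \<open>h1 \<noteq> e\<close> \<open>h2 \<noteq> e\<close> \<open>h1 \<noteq> h2\<close> by auto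
  then have card_P: "card ?P = m - 3"
    using card_Diff_subset[of "{h1, e, h2}" E] h1(3) h2(3) \<open>e \<in> E\<close> card_E by simp
  have E_eq: "E = {h1, e, h2} \<union> ?P \<union> {}"
    using h1(3) h2(3) \<open>e \<in> E\<close> by blast
  have "pendant_triangle H v u w (m - 3) 0"
    using card_P U[of u] U[of w] uw(2) v(1) ue we h1(2) h2(2) \<open>v \<notin> e\<close> \<open>u \<notin> h2\<close> \<open>w \<notin> h1\<close> fin_E
    by (intro pendant_triangleI[OF _ _ _ _ _ _ deg1 E_eq _ _ _ _ _ _ _ _ _ P]) simp_all
  then show ?thesis
    by blast
qed

text \<open>Two edges avoid v; u lies on both and on one edge through v. One unit of excess remains,
  so one further vertex w has degree 2. It lies on exactly one of the two edges and on another edge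
  through v; the edge missed by w becomes the pendant edge at u.\<close>

lemma pendant_triangle_if_vdegree_second:
  assumes v: "v \<in> V" "vdegree H v = m - 2" and u: "u \<in> V" "u \<noteq> v" "vdegree H u = 3"
  shows "\<exists>w. pendant_triangle H v u w (m - 4) 1"
proof -
  let ?x = excess
  have "card (E - star v) = 2"
    using card_avoiding[of v] v(2) m by simp
  then obtain e0 f0 where ef0: "E - star v = {e0, f0}" "e0 \<noteq> f0"
    by (metis card_2_iff)
  have "sum ?x V = ?x v + (?x u + sum ?x (V - {v} - {u}))"
    using sum.remove[OF finite_verts v(1), of ?x] sum.remove[of "V - {v}" u ?x] u(1,2) by simp
  then have "sum ?x (V - {v} - {u}) = 1"
    using sum_excess v(2) u(3) m by simp
  moreover have "finite (V - {v} - {u})"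
    by simp
  ultimately obtain w where
    w: "w \<in> V - {v} - {u}" "?x w = 1" "\<forall>y\<in>V - {v} - {u}. w \<noteq> y \<longrightarrow> ?x y = 0"
    unfolding sum_eq_1_iff[OF \<open>finite (V - {v} - {u})\<close>] by blast
  have deg1: "vdegree H y = 1" if "y \<in> V - {v, u, w}" for y
    using w(3) that vdegree_pos[of y] by (auto simp: le_antisym)
  have dw: "vdegree H w = 2"
    using w(2) by simp
  have star_u: "\<exists>h. star u = {h, e0, f0} \<and> v \<in> h \<and> h \<in> E"
  proof (rule star_decompose[of u v])
    fix h assume h: "star u \<subseteq> insert h (E - star v)" "h \<in> star u \<inter> star v"
    then have "h \<notin> {e0, f0}"
      using ef0(1) by blast
    then have "star u = {h, e0, f0}"
      using h(1) u(3) ef0(2) unfolding ef0(1) by (intro star_eqI) auto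
    then show ?thesis
      using h(2) by blast
  next
    assume "star u \<subseteq> E - star v"
    then have "card (star u) \<le> card {e0, f0}"
      unfolding ef0(1) by (intro card_mono) auto
    then show ?thesis
      using u(3) ef0(2) by (simp add: vdegree_def)
  qed (use u in auto)
  then obtain h where h: "star u = {h, e0, f0}" "v \<in> h" "h \<in> E"
    by blast
  have ef0_u: "u \<in> e0" "u \<in> f0" "u \<in> h" and ef0_E: "e0 \<in> E" "f0 \<in> E" and ef0_v: "v \<notin> e0" "v \<notin> f0"
    using h ef0(1) by blast+
  \<comment> \<open>The two edges avoiding v already share u.\<close>
  have not_both: "\<not> (w \<in> e0 \<and> w \<in> f0)"
    using unique_edge[of e0 f0 u w] ef0_u ef0_E ef0(2) w(1) by blast
  have "\<exists>h' e. star w = {h', e} \<and> v \<in> h' \<and> h' \<in> E \<and> e \<in> {e0, f0}"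
  proof (rule star_decompose[of w v])
    fix h' assume h': "star w \<subseteq> insert h' (E - star v)" "h' \<in> star w \<inter> star v"
    then obtain e where e: "star w \<subseteq> {h', e}" "e \<in> {e0, f0}"
      using not_both unfolding ef0(1) by blast
    have "h' \<noteq> e"
      using e(2) h'(2) ef0_v by blast
    then have "star w = {h', e}"
      using e(1) dw by (intro star_eqI) auto
    then show ?thesis
      using h'(2) e(2) by blast
  next
    assume "star w \<subseteq> E - star v"
    then have "star w \<subseteq> {e0} \<or> star w \<subseteq> {f0}"
      unfolding ef0(1) using not_both by blast
    then have "card (star w) \<le> 1"
      using card_mono[of "{e0}" "star w"] card_mono[of "{f0}" "star w"] by auto
    then show ?thesis
      using dw by (simp add: vdegree_def)
  qed (use w in auto)
  then obtain h' e where h': "star w = {h', e}" "v \<in> h'" "h' \<in> E" "e \<in> {e0, f0}"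
    by blast
  \<comment> \<open>The two edges avoiding v are renamed so that w lies on e; f will be the pendant
    edge at u.\<close>
  obtain f where f: "e = e0 \<and> f = f0 \<or> e = f0 \<and> f = e0"
    using h'(4) by blast
  then have f': "{e, f} = {e0, f0}" "e \<noteq> f"
    using ef0(2) by auto
  have ef: "u \<in> e" "u \<in> f" "e \<in> E" "f \<in> E" "v \<notin> e" "v \<notin> f"
    using f ef0_u ef0_E ef0_v by metis+
  have star_v: "E - star v = {e, f}" and star_u': "star u = {h, e, f}"
    unfolding ef0(1) h(1) f'(1) by simp_all
  have we: "w \<in> e" "w \<in> h'"
    using h'(1) by blast+
  have neq: "h \<noteq> e" "h \<noteq> f" "h' \<noteq> e" "h' \<noteq> f"
    using ef(5,6) h(2) h'(2) by blast+
  have "w \<notin> f"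
    using unique_edge[of e f u w] ef we f'(2) w(1) by blast
  have "w \<notin> h"
    using unique_edge[of h e u w] ef we ef0_u(3) h(3) neq(1) w(1) by blast
  then have "h' \<noteq> h"
    using we(2) by blast
  then have "u \<notin> h'"
    using star_u' h'(3) neq by blast
  let ?P = "E - {h, e, h', f}"
  have P: "v \<in> g \<and> u \<notin> g \<and> w \<notin> g" if "g \<in> ?P" for g
  proof -
    have "g \<notin> star u" "g \<notin> star w" "g \<notin> E - star v"
      unfolding star_u' h'(1) star_v using that by auto
    then show ?thesis
      using that by simp
  qed
  have "card {h, e, h', f} = 4"
    using neq f'(2) \<open>h' \<noteq> h\<close> by auto
  then have card_P: "card ?P = m - 4"
    using card_Diff_subset[of "{h, e, h', f}" E] h(3) h'(3) ef(3,4) card_E by simp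
  have E_eq: "E = {h, e, h'} \<union> ?P \<union> {f}"
    using h(3) h'(3) ef(3,4) by blast
  have "pendant_triangle H v u w (m - 4) 1"
    using card_P u(1,2) w(1) v(1) ef we h(2) h'(2) ef0_u(3) \<open>u \<notin> h'\<close> \<open>w \<notin> h\<close> \<open>w \<notin> f\<close> fin_E
    by (intro pendant_triangleI[OF _ _ _ _ _ _ deg1 E_eq _ _ _ _ _ _ _ _ _ P]) simp_all
  then show ?thesis
    by blast
qed

text \<open>The cases are a largest excess of m - 2, of m - 3, or of at most m - 4. The strict bound
  is the value for the excess sequence m - 3, 2, 1, 0, ... translated back to degrees.\<close>

lemma classification:
  "(\<exists>v u w. pendant_triangle H v u w (m - 3) 0) \<or> (\<exists>v u w. pendant_triangle H v u w (m - 4) 1) \<or>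
    degree_square_sum H < (m - 3)\<^sup>2 + 5 + 2 * m + nverts H"
proof -
  let ?x = excess
  have "V \<noteq> {}"
    using sum_excess m by force
  then obtain v where v: "v \<in> V" "\<And>u. u \<in> V \<Longrightarrow> vdegree H u \<le> vdegree H v"
    using obtains_MAX[of V "vdegree H"] by (metis Max_ge finite_imageI finite_verts imageI)
  have pair: "?x v + ?x u + 1 \<le> m" if "u \<in> V" "u \<noteq> v" for u
    using vdegree_pair[OF that(2)] vdegree_pos[OF that(1)] vdegree_pos[OF v(1)] by simp
  consider "vdegree H v = m - 1" | "vdegree H v = m - 2" | "?x v + 4 \<le> m"
    using vdegree_less[OF v(1)] m by linarith
  then show ?thesis
  proof cases
    case 1
    then show ?thesis
      using pendant_triangle_if_vdegree_max[OF v(1)] by blast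
  next
    case 2
    show ?thesis
    proof (cases "\<exists>u\<in>V. u \<noteq> v \<and> vdegree H u = 3")
      case True
      then show ?thesis
        using pendant_triangle_if_vdegree_second[OF v(1) 2] by blast
    next
      \<comment> \<open>Without a vertex of degree 3 the excesses besides that of v are 0 or 1 and
        total 3, which gives only (m - 3)^2 + 3.\<close>
      case False
      have "(?x u)\<^sup>2 = ?x u" if "u \<in> V - {v}" for u
      proof -
        have "?x u \<le> 2"
          using pair[of u] that 2 m by simp
        moreover have "?x u \<noteq> 2"
          using False that by auto
        ultimately have "?x u = 0 \<or> ?x u = 1"
          by linarith
        then show ?thesis
          by auto
      qed
      then have "(\<Sum>u\<in>V - {v}. (?x u)\<^sup>2) = (\<Sum>u\<in>V - {v}. ?x u)"
        by (intro sum.cong) auto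
      also have "\<dots> = 3"
        using sum.remove[OF finite_verts v(1), of ?x] sum_excess 2 m by simp
      finally have "(\<Sum>u\<in>V. (?x u)\<^sup>2) = (m - 3)\<^sup>2 + 3"
        using sum.remove[OF finite_verts v(1), of "\<lambda>u. (?x u)\<^sup>2"] 2 by (simp add: numeral_3_eq_3)
      then show ?thesis
        by (simp add: degree_square_sum_excess)
    qed
  next
    case 3
    have "(\<Sum>u\<in>V. (?x u)\<^sup>2) < (m - 3)\<^sup>2 + 5"
      using sum_excess m v(1) 3 pair v(2)
      by (intro sum_squares_less[where v = v]) (auto intro: diff_le_mono)
    then show ?thesis
      by (simp add: degree_square_sum_excess)
  qed
qed

end

text \<open>The range m \<ge> 5 is where the statement makes sense. For m = 4,
  \<open>C3_pendant k 0 1 0\<close> is isomorphic to \<open>C3_pendant k 1 0 0\<close>, which is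
  already the hypergraph \<open>?L\<close> of the proof; for m = 3 the truncated
  \<open>m - 4\<close> is 0 and the hypergraph has four hyperedges.\<close>

theorem theorem5p3:
  fixes k m :: nat and \<alpha> :: real
  assumes "k \<ge> 2" and "m \<ge> 5" and "0 < \<alpha>" and "\<alpha> < 1"
  shows "is_second_last \<alpha> k (linear_unicyclic_class k m) (C3_pendant k (m - 4) 1 0)"
proof -
  let ?C = "linear_unicyclic_class k m"
  let ?L = "C3_pendant k (m - 3) 0 0" and ?S = "C3_pendant k (m - 4) 1 0"
  let ?n = "m * (k - 1)"
  have L: "?L \<in> ?C" and S: "?S \<in> ?C"
    using C3_pendant_linear_unicyclic[OF assms(1), of "m - 3" 0 0]
      C3_pendant_linear_unicyclic[OF assms(1), of "m - 4" 1 0] assms(2) by simp_all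
  have tL: "pendant_triangle ?L 0 1 2 (m - 3) 0" and tS: "pendant_triangle ?S 0 1 2 (m - 4) 1"
    by (rule pendant_triangle_C3_pendant[OF assms(1)])+
  have classD: "wf_hgraph G" "uniform_hgraph k G" "\<Union>(hedges G) = verts G" "card (hedges G) = m" "nverts G = ?n"
    if "G \<in> ?C" for G
    using that assms(1,2) linear_unicyclic_class_iff[of k m G] linear_unicyclic_nverts[of k m G] by simp_all
  have n: "?n \<ge> 3"
    using mult_le_mono[of 3 m 1 "k - 1"] assms(1,2) by simp
  have less: "S_less \<alpha> k G G'"
    if "G \<in> ?C" "G' \<in> ?C" "degree_square_sum G < degree_square_sum G'" for G G'
    using classD[OF that(1)] classD[OF that(2)] that(3) n assms(1,3)
    by (intro S_less_if_degree_square_sum_less) simp_all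
  obtain r where r: "m = r + 5"
    using assms(2) by (metis add.commute le_Suc_ex)
  have dS: "degree_square_sum G = (m - 3)\<^sup>2 + 5 + 2 * m + ?n"
    if "pendant_triangle G v u w (m - 4) 1" "G \<in> ?C" for G v u w
  proof -
    have "degree_square_sum G + 3 = (m - 4 + 2)\<^sup>2 + (1 + 2)\<^sup>2 + 4 + ?n"
      using pendant_triangle_degree_square_sum[OF that(1)] classD(5)[OF that(2)] by simp
    moreover have "(m - 4 + 2)\<^sup>2 + (1 + 2)\<^sup>2 + 4 = (m - 3)\<^sup>2 + 5 + 2 * m + 3"
      unfolding r power2_eq_square by (simp add: algebra_simps)
    ultimately show ?thesis
      by linarith
  qed
  have dL: "(m - 3)\<^sup>2 + 5 + 2 * m + ?n < degree_square_sum G"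
    if "pendant_triangle G v u w (m - 3) 0" "G \<in> ?C" for G v u w
  proof -
    have "degree_square_sum G + 3 = (m - 3 + 2)\<^sup>2 + (0 + 2)\<^sup>2 + 4 + ?n"
      using pendant_triangle_degree_square_sum[OF that(1)] classD(5)[OF that(2)] by simp
    moreover have "(m - 3)\<^sup>2 + 5 + 2 * m + 3 < (m - 3 + 2)\<^sup>2 + (0 + 2)\<^sup>2 + 4"
      unfolding r power2_eq_square by (simp add: algebra_simps)
    ultimately show ?thesis
      by linarith
  qed
  \<comment> \<open>The equal sums in the second case are recorded because a copy of
    \<open>?S\<close> must also be shown to come before \<open>?L\<close>.\<close>
  have cases: "iso_hgraph G ?L \<or> iso_hgraph G ?S \<and> degree_square_sum G = degree_square_sum ?S \<or>
      degree_square_sum G < degree_square_sum ?S" if G: "G \<in> ?C" for G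
  proof -
    interpret linear_unicyclic G k m
      using assms(1,2) G by unfold_locales
    have "iso_hgraph G ?L" if "pendant_triangle G v u w (m - 3) 0" for v u w
      using pendant_triangle_iso[OF that classD(1-3)[OF G] tL classD(1-3)[OF L] assms(1)] .
    moreover have "iso_hgraph G ?S \<and> degree_square_sum G = degree_square_sum ?S"
      if "pendant_triangle G v u w (m - 4) 1" for v u w
      using pendant_triangle_iso[OF that classD(1-3)[OF G] tS classD(1-3)[OF S] assms(1)]
        dS[OF that G] dS[OF tS S] by simp
    ultimately show ?thesis
      using classification dS[OF tS S] classD(5)[OF G] by metis
  qed
  have SL: "degree_square_sum ?S < degree_square_sum ?L"
    using dS[OF tS S] dL[OF tL L] by simp
  then have "\<not> iso_hgraph ?S ?L"
    using iso_hgraph_degree_square_sum[OF _ classD(1)[OF S], of ?L] by auto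
  moreover have "S_less \<alpha> k G ?L" if "G \<in> ?C" "\<not> iso_hgraph G ?L" for G
    using cases[OF that(1)] that SL less[OF that(1) L] by auto
  moreover have "S_less \<alpha> k G ?S" if "G \<in> ?C" "\<not> iso_hgraph G ?L" "\<not> iso_hgraph G ?S" for G
    using cases[OF that(1)] that less[OF that(1) S] by auto
  ultimately show ?thesis
    unfolding is_second_last_def is_last_def using L S by blast
qed

end
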